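(* Let $G$ be an open subgroup of the normalizer $N$ of a ramified Cartan subgroup $C$ of $\mathrm{GL}_2(\mathbb{Z}_\ell)$, with level $n_0$. Let $a\geq0$ with $a=0$ if $\ell$ is odd and $a\in\{0,1\}$ if $\ell=2$, let $b\geq0$ and $n\geq1$. Write $(G\setminus C)(n)$ for the image of $G\setminus C$ in $\mathrm{GL}_2(\mathbb{Z}/\ell^n\mathbb{Z})$. If $\ell$ is odd, let $\mathcal{N}_{a,b}(n)$ be the set of $M\in(G\setminus C)(n)$ with $\det(M-I)\equiv0\pmod{\ell^n}$ if $n\leq b$, and $v_\ell(\det(M-I))=b$ if $n>b$; and set $f(n)=\ell$ if $n<b$, $f(n)=\ell(\ell-1)$ if $n=b$, $f(n)=\ell^2$ if $n>b$. If $\ell=2$, let $\mathcal{N}_{a,b}(n)$ be the set of $M\in(G\setminus C)(n)$ such that $M\equiv I\pmod{2^a}$, $M\not\equiv I\pmod{2^{a+1}}$, and $\det(M-I)\equiv 0\pmod{2^{n+1}}$ if $n<2a+b$, while $v_2(\det(M-I))=2a+b$ if $n\geq 2a+b$ (for such $M$, $\det(M-I)$ is well defined modulo $2^{n+1}$); and set $f(n)=2$ if $n<2a+b$, $f(n)=4$ if $n\geq2a+b$. Then: (i) for every $n\geq n_0$, each matrix in $\mathcal{N}_{a,b}(n)$ has exactly $f(n)$ lifts to $\mathcal{N}_{a,b}(n+1)$ (matrices congruent to it modulo $\ell^n$), so $\#\mathcal{N}_{a,b}(n+1)=f(n)\,\#\mathcal{N}_{a,b}(n)$; (ii) if $n\geq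 n_0$ or $n>a+b$, then $\mathcal{M}^*_{a,b}(n)=\mathcal{N}_{a,b}(n)$.
   Context: Let $\ell$ be a prime. A quadratic ring over $\mathbb{Z}_\ell$ is a subring $R$ (containing $1$) of a reduced $\mathbb{Q}_\ell$-algebra $F$ of degree $2$ such that $R$ is a finitely generated $\mathbb{Z}_\ell$-module and $\mathbb{Q}_\ell R=F$; $\mathcal{O}_F$ is the maximal order. The Cartan subgroup associated with $R$ is $R^\times$ embedded in $\mathrm{GL}_2(\mathbb{Z}_\ell)$ via left multiplication on $R$ in a $\mathbb{Z}_\ell$-basis; it is ramified unless $\ell\nmid[\mathcal{O}_F:R]$ and $F$ is $\mathbb{Q}_\ell^2$ or the unramified quadratic field extension of $\mathbb{Q}_\ell$. The normalizer is taken in $\mathrm{GL}_2(\mathbb{Z}_\ell)$. For $X\subseteq\mathrm{GL}_2(\mathbb{Z}_\ell)$, $X(n)$ is its image in $\mathrm{GL}_2(\mathbb{Z}/\ell^n\mathbb{Z})$. Level: let $n$ be the smallest positive integer with $[N(n):G(n)]=[N:G]$; the level $n_0$ of $G$ is $\max\{n,2\}$ if $\ell=2$ and $n$ otherwise. Identify $M\in\mathrm{GL}_2(\mathbb{Z}_\ell)$ with an automorphism of $\varinjlim_n(\mathbb{Z}/\ell^n\mathbb{Z})^2$; $\mathcal{M}_{a,b}=\{M\in G:\ \ker(M-I)\cong\mathbb{Z}/\ell^a\mathbb{Z}\times\mathbb{Z}/\ell^{a+b}\mathbb{Z}\}$, $\mathcal{M}^*_{a,b}=(N\setminus C)\cap\mathcal{M}_{a,b}$,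 and $\mathcal{M}^*_{a,b}(n)$ is the image of $\mathcal{M}^*_{a,b}$ in $\mathrm{GL}_2(\mathbb{Z}/\ell^n\mathbb{Z})$. *)

theory Defs
  imports Main "HOL-Algebra.Algebra" "HOL-Computational_Algebra.Primes"
begin

type_synonym mat2 = "int \<times> int \<times> int \<times> int"  \<comment> \<open>(a,b,c,d) = [[a,b],[c,d]]\<close>

fun mul2 :: "mat2 \<Rightarrow> mat2 \<Rightarrow> mat2" where
  "mul2 (p,q,r,s) (p',q',r',s') = (p*p' + q*r', p*q' + q*s', r*p' + s*r', r*q' + s*s')"

fun det2 :: "mat2 \<Rightarrow> int" where
  "det2 (p,q,r,s) = p*s - q*r"

fun sub2 :: "mat2 \<Rightarrow> mat2 \<Rightarrow> mat2" where
  "sub2 (p,q,r,s) (p',q',r',s') = (p-p', q-q', r-r', s-s')"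

definition id2 :: mat2 where "id2 = (1,0,0,1)"

fun redm :: "int \<Rightarrow> mat2 \<Rightarrow> mat2" where
  "redm m (p,q,r,s) = (p mod m, q mod m, r mod m, s mod m)"

text \<open>An element of Z_l is the sequence of its residues x n in {0..<l^n}.\<close>
definition Zl :: "nat \<Rightarrow> (nat \<Rightarrow> int) set" where
  "Zl l = {x. \<forall>n. 0 \<le> x n \<and> x n < int l ^ n \<and> x (Suc n) mod (int l ^ n) = x n}"

text \<open>A 2x2 matrix over Z_l is the sequence of its reductions M n modulo l^n
  (entries normalised into {0..<l^n}); M(n) is the image in GL_2(Z/l^n).\<close>
definition Matl :: "nat \<Rightarrow> (nat \<Rightarrow> mat2) set" where
  "Matl l = {M. \<forall>n. redm (int l ^ n) (M n) = M n \<and> redm (int l ^ n) (M (Suc n)) = M n}"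

definition GL2 :: "nat \<Rightarrow> (nat \<Rightarrow> mat2) set" where
  "GL2 l = {M \<in> Matl l. \<not> int l dvd det2 (M 1)}"

definition lmul :: "nat \<Rightarrow> (nat \<Rightarrow> mat2) \<Rightarrow> (nat \<Rightarrow> mat2) \<Rightarrow> (nat \<Rightarrow> mat2)" where
  "lmul l M N = (\<lambda>n. redm (int l ^ n) (mul2 (M n) (N n)))"

definition lid :: "nat \<Rightarrow> (nat \<Rightarrow> mat2)" where
  "lid l = (\<lambda>n. redm (int l ^ n) id2)"

definition img :: "(nat \<Rightarrow> mat2) set \<Rightarrow> nat \<Rightarrow> mat2 set" where
  "img S k = (\<lambda>A. A k) ` S"

text \<open>Every quadratic ring over Z_l is Z_l[w] with w^2 = t w - d, t,d in Z_l, and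
  the algebra Q_l R is reduced iff the discriminant t^2-4d is nonzero.  Left
  multiplication by x + y w in the basis (1,w) has matrix [[x,-dy],[y,x+ty]].\<close>
definition std_cartan :: "nat \<Rightarrow> (nat \<Rightarrow> int) \<Rightarrow> (nat \<Rightarrow> int) \<Rightarrow> (nat \<Rightarrow> mat2) set" where
  "std_cartan l t d = {M \<in> GL2 l. \<exists>x\<in>Zl l. \<exists>y\<in>Zl l. \<forall>n.
       M n = redm (int l ^ n) (x n, - (d n * y n), y n, x n + t n * y n)}"

text \<open>A Cartan subgroup: the standard one for some quadratic ring, written in an
  arbitrary Z_l-basis (i.e. conjugated by some P in GL_2(Z_l)).  It is ramified
  iff l divides the discriminant (i.e. R/lR is not etale over F_l).\<close>
definition cartan_data :: "nat \<Rightarrow> (nat \<Rightarrow> mat2) set \<Rightarrow> (nat \<Rightarrow> int) \<Rightarrow> (nat \<Rightarrow> int) \<Rightarrow> bool" where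
  "cartan_data l C t d \<longleftrightarrow> t \<in> Zl l \<and> d \<in> Zl l \<and>
     (\<exists>n. (t n ^ 2 - 4 * d n) mod (int l ^ n) \<noteq> 0) \<and>
     (\<exists>P\<in>GL2 l. \<exists>Q\<in>GL2 l. lmul l P Q = lid l \<and> lmul l Q P = lid l \<and>
        C = (\<lambda>A. lmul l P (lmul l A Q)) ` std_cartan l t d)"

definition ramified_cartan :: "nat \<Rightarrow> (nat \<Rightarrow> mat2) set \<Rightarrow> bool" where
  "ramified_cartan l C \<longleftrightarrow> (\<exists>t d. cartan_data l C t d \<and> int l dvd (t 1 ^ 2 - 4 * d 1))"

definition normalizer :: "nat \<Rightarrow> (nat \<Rightarrow> mat2) set \<Rightarrow> (nat \<Rightarrow> mat2) set" where
  "normalizer l C = {g \<in> GL2 l. \<exists>g'\<in>GL2 l. lmul l g g' = lid l \<and> lmul l g' g = lid l \<and>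
      (\<lambda>h. lmul l g (lmul l h g')) ` C = C}"

definition open_subgroup_of :: "nat \<Rightarrow> (nat \<Rightarrow> mat2) set \<Rightarrow> (nat \<Rightarrow> mat2) set \<Rightarrow> bool" where
  "open_subgroup_of l G N \<longleftrightarrow> G \<subseteq> N \<and> lid l \<in> G \<and>
     (\<forall>g\<in>G. \<forall>h\<in>G. lmul l g h \<in> G) \<and>
     (\<forall>g\<in>G. \<exists>h\<in>G. lmul l g h = lid l) \<and>
     (\<exists>k. {h \<in> N. h k = lid l k} \<subseteq> G)"

definition index_l :: "nat \<Rightarrow> (nat \<Rightarrow> mat2) set \<Rightarrow> (nat \<Rightarrow> mat2) set \<Rightarrow> nat" where
  "index_l l N G = card ((\<lambda>g. (lmul l g) ` G) ` N)"

definition index_n :: "nat \<Rightarrow> nat \<Rightarrow> mat2 set \<Rightarrow> mat2 set \<Rightarrow> nat" where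
  "index_n l n N G = card ((\<lambda>g. (\<lambda>h. redm (int l ^ n) (mul2 g h)) ` G) ` N)"

definition level :: "nat \<Rightarrow> (nat \<Rightarrow> mat2) set \<Rightarrow> (nat \<Rightarrow> mat2) set \<Rightarrow> nat" where
  "level l N G = (let m = (LEAST n. 0 < n \<and> index_n l n (img N n) (img G n) = index_l l N G)
                  in if l = 2 then max m 2 else m)"

text \<open>Q_l/Z_l is modelled as the rationals in [0,1) with l-power denominator.\<close>
definition QZ2 :: "nat \<Rightarrow> (rat \<times> rat) monoid" where
  "QZ2 l = \<lparr> carrier = {(r,s). 0 \<le> r \<and> r < 1 \<and> 0 \<le> s \<and> s < 1 \<and>
                 (\<exists>m. r * of_nat l ^ m \<in> \<int> \<and> s * of_nat l ^ m \<in> \<int>)},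
            monoid.mult = (\<lambda>(r,s) (u,v). (frac (r + u), frac (s + v))),
            one = (0,0) \<rparr>"

text \<open>Action of M on (Q_l/Z_l)^2: if v is killed by l^m, use M(m).\<close>
definition act :: "nat \<Rightarrow> (nat \<Rightarrow> mat2) \<Rightarrow> rat \<times> rat \<Rightarrow> rat \<times> rat" where
  "act l M v = (let m = (LEAST m. fst v * of_nat l ^ m \<in> \<int> \<and> snd v * of_nat l ^ m \<in> \<int>) in
     (case M m of (p,q,r,s) \<Rightarrow>
        (frac (of_int p * fst v + of_int q * snd v), frac (of_int r * fst v + of_int s * snd v))))"

definition kerMI :: "nat \<Rightarrow> (nat \<Rightarrow> mat2) \<Rightarrow> (rat \<times> rat) set" where
  "kerMI l M = {v \<in> carrier (QZ2 l). act l M v = v}"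

definition Mab :: "nat \<Rightarrow> (nat \<Rightarrow> mat2) set \<Rightarrow> nat \<Rightarrow> nat \<Rightarrow> (nat \<Rightarrow> mat2) set" where
  "Mab l G a b = {M \<in> G. (QZ2 l)\<lparr>carrier := kerMI l M\<rparr> \<cong>
        DirProd (integer_mod_group (l ^ a)) (integer_mod_group (l ^ (a + b)))}"

definition Mstar :: "nat \<Rightarrow> (nat \<Rightarrow> mat2) set \<Rightarrow> (nat \<Rightarrow> mat2) set \<Rightarrow> (nat \<Rightarrow> mat2) set
     \<Rightarrow> nat \<Rightarrow> nat \<Rightarrow> nat \<Rightarrow> mat2 set" where
  "Mstar l G C N a b n = img ((N - C) \<inter> Mab l G a b) n"

definition val_eq :: "nat \<Rightarrow> int \<Rightarrow> nat \<Rightarrow> bool" where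
  "val_eq l D b \<longleftrightarrow> D \<noteq> 0 \<and> multiplicity (int l) D = b"

definition Nab :: "nat \<Rightarrow> (nat \<Rightarrow> mat2) set \<Rightarrow> (nat \<Rightarrow> mat2) set \<Rightarrow> nat \<Rightarrow> nat \<Rightarrow> nat \<Rightarrow> mat2 set" where
  "Nab l G C a b n =
    (if l \<noteq> 2 then
       {M \<in> img (G - C) n.
          (if n \<le> b then det2 (sub2 M id2) mod (int l ^ n) = 0
           else val_eq l (det2 (sub2 M id2) mod (int l ^ n)) b)}
     else
       {M \<in> img (G - C) n.
          redm (2 ^ a) (sub2 M id2) = (0,0,0,0) \<and> redm (2 ^ (a+1)) (sub2 M id2) \<noteq> (0,0,0,0) \<and>
          (\<exists>M'\<in>G - C. M' n = M \<and>
             (let D = det2 (sub2 (M' (Suc n)) id2) mod (2 ^ (n+1)) in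
              if n < 2*a + b then D = 0 else val_eq 2 D (2*a + b)))})"

definition fN :: "nat \<Rightarrow> nat \<Rightarrow> nat \<Rightarrow> nat \<Rightarrow> nat" where
  "fN l a b n =
    (if l \<noteq> 2 then (if n < b then l else if n = b then l * (l - 1) else l ^ 2)
     else (if n < 2*a + b then 2 else 4))"

end

theory Submission
  imports Defs "HOL-Number_Theory.Cong"
begin

text \<open>
  Write \<open>R = Z_l[w]\<close> with \<open>w\<^sup>2 = tw - d\<close>. An automorphism normalising \<open>R\<^sup>\<times>\<close> conjugates \<open>1 + lw\<close> into
  \<open>R\<close>, so it either commutes with \<open>w\<close> or maps \<open>w\<close> to \<open>t - w\<close>; hence \<open>N - C\<close> consists of the maps
  \<open>M = (x + yw) \<circ> \<sigma>\<close> with \<open>\<sigma>\<close> the conjugation. These have trace 0, so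
  \<open>det (M - I) = 1 - Nm (x + yw)\<close>. From \<open>n \<ge> n\<^sub>0\<close> on, the lifts of \<open>M\<close> to level \<open>n + 1\<close>
  are the \<open>(x + l\<^sup>n u, y + l\<^sup>n v)\<close> for all \<open>u, v\<close> modulo \<open>l\<close>, and since \<open>l\<close> divides \<open>t\<^sup>2 - 4d\<close> but not the norm,
  the next digit of \<open>det (M - I)\<close> (modulo \<open>l\<^sup>n\<^sup>+\<^sup>2\<close> if \<open>l = 2\<close>) is a
  nonconstant affine function of \<open>(u, v)\<close>: each value is taken exactly \<open>l\<close> times.
  Finally, if \<open>M - I\<close> is \<open>l\<^sup>a\<close> times a matrix that is nonzero modulo \<open>l\<close>, then \<open>ker (M - I)\<close> is determined by
  \<open>a\<close> and the valuation of \<open>det (M - I)\<close>.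
\<close>

subsection \<open>Matrices over the l-adic integers\<close>

text \<open>The level is defined by an equality of indices. What makes it useful is that, from the
  level on, \<open>G\<close> contains every element of \<open>N\<close> congruent to the identity
  modulo \<open>l ^ n\<close>, so lifts can be chosen anywhere in \<open>N\<close>, where the
  coordinates are free. The prime 2 shapes the rest. There t is even and both partial derivatives of
  the norm form are even, so M modulo \<open>2 ^ n\<close> already fixes det (M - I) modulo
  \<open>2 ^ (n + 1)\<close>, and a lift can only change the digit after that. The quadratic term of
  the norm form stays away from this digit if 2n \<ge> n + 2, which is where the bound 2 in the
  level comes from. Counting the extra digits by \<open>eps\<close> turns both cases into one
  argument. In part (ii), \<open>Nab\<close> sees a truncated valuation. From the level on, finitely
  many successive lifts make it exact, and no limit is taken. For n > a + b the valuation is already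
  visible, because a is at most \<open>eps\<close> and hence 2a + b < n + eps.\<close>

lemma mul2_assoc: "mul2 (mul2 A B) D = mul2 A (mul2 B D)"
  by (cases A; cases B; cases D) (simp add: algebra_simps)

lemma mul2_id2 [simp]: "mul2 id2 A = A" "mul2 A id2 = A"
  by (cases A; simp add: id2_def)+

lemma det2_mul2: "det2 (mul2 A B) = det2 A * det2 B"
  by (cases A; cases B) (simp add: algebra_simps)

lemma redm_eq_iff:
  "redm m (p,q,r,s) = redm m (p',q',r',s') \<longleftrightarrow>
     m dvd p - p' \<and> m dvd q - q' \<and> m dvd r - r' \<and> m dvd s - s'"
  by (simp add: mod_eq_dvd_iff)

lemma redm_redm: "m' dvd m \<Longrightarrow> redm m' (redm m A) = redm m' A"
  by (cases A) (simp add: mod_mod_cancel)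

lemma redm_idem [simp]: "redm m (redm m A) = redm m A"
  by (simp add: redm_redm)

lemma redm_cong_dvd: "redm m A = redm m B \<Longrightarrow> m' dvd m \<Longrightarrow> redm m' A = redm m' B"
  by (metis redm_redm)

lemma redm_mul2_cong:
  assumes "redm m A = redm m A'" "redm m B = redm m B'"
  shows "redm m (mul2 A B) = redm m (mul2 A' B')"
proof (cases A; cases B; cases A'; cases B')
  fix p q r s p' q' r' s' x y z w x' y' z' w'
  assume *: "A = (p,q,r,s)" "A' = (p',q',r',s')" "B = (x,y,z,w)" "B' = (x',y',z',w')"
  have "[p = p'] (mod m)" "[q = q'] (mod m)" "[r = r'] (mod m)" "[s = s'] (mod m)"
    "[x = x'] (mod m)" "[y = y'] (mod m)" "[z = z'] (mod m)" "[w = w'] (mod m)"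
    using assms unfolding * by (simp_all add: cong_def)
  hence "[p * x + q * z = p' * x' + q' * z'] (mod m)" "[p * y + q * w = p' * y' + q' * w'] (mod m)"
   "[r * x + s * z = r' * x' + s' * z'] (mod m)" "[r * y + s * w = r' * y' + s' * w'] (mod m)"
    by (auto intro!: cong_add cong_mult)
  thus ?thesis unfolding * by (simp add: cong_def)
qed
lemma redm_mul2 [simp]:
  "redm m (mul2 (redm m A) B) = redm m (mul2 A B)"
  "redm m (mul2 A (redm m B)) = redm m (mul2 A B)"
  by (rule redm_mul2_cong; simp)+
lemma redm_sub2_cong:
  "redm m A = redm m A' \<Longrightarrow> redm m (sub2 A B) = redm m (sub2 A' B)"
  by (cases A; cases A'; cases B) (simp add: mod_eq_dvd_iff)

lemma redm_sub2_eq_0: "redm m (sub2 A B) = (0,0,0,0) \<longleftrightarrow> redm m A = redm m B"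
  by (cases A; cases B) (simp add: mod_eq_dvd_iff mod_eq_0_iff_dvd)

lemma det2_redm: 
  assumes "redm m A = redm m A'" shows "det2 A mod m = det2 A' mod m"
proof (cases A; cases A')
  fix p q r s p' q' r' s' 
  assume *: "A = (p,q,r,s)" "A' = (p',q',r',s')" 
  have "[p = p'] (mod m)" "[q = q'] (mod m)" "[r = r'] (mod m)" "[s = s'] (mod m)"
    using assms unfolding * by (simp_all add: cong_def)
  hence "[p * s - q * r = p' * s' - q' * r'] (mod m)"
    by (auto intro!: cong_diff cong_mult)
  thus ?thesis unfolding * by (simp add: cong_def)
qed

text \<open>Inverses chosen independently at each level agree after reduction by this argument, so
  they form a coherent sequence.\<close>

lemma redm_inverse_unique:
  assumes "redm m (mul2 F M) = redm m id2" "redm m (mul2 M F') = redm m id2"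
  shows "redm m F = redm m F'"
proof -
  have "redm m F = redm m (mul2 F (mul2 M F'))"
    using assms(2) by (metis mul2_id2(2) redm_mul2(2))
  also have "\<dots> = redm m (mul2 id2 F')"
    using assms(1) by (metis mul2_assoc redm_mul2(1))
  finally show ?thesis by simp
qed

lemma lmul_assoc: "lmul l (lmul l A B) D = lmul l A (lmul l B D)"
  by (simp add: lmul_def mul2_assoc)

lemma lmul_lid: "A \<in> Matl l \<Longrightarrow> lmul l (lid l) A = A" "A \<in> Matl l \<Longrightarrow> lmul l A (lid l) = A"
  by (auto simp: lmul_def lid_def Matl_def)

lemma MatlI:
  assumes "\<And>n. redm (int l ^ n) (F (Suc n)) = redm (int l ^ n) (F n)"
  shows "(\<lambda>n. redm (int l ^ n) (F n)) \<in> Matl l"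
  using assms by (simp add: Matl_def redm_redm)

lemma Matl_redm:
  assumes "M \<in> Matl l" "k \<le> n"
  shows "redm (int l ^ k) (M n) = M k"
  using assms(2)
proof (induction n rule: dec_induct)
  case base
  then show ?case using assms(1) by (simp add: Matl_def)
next
  case (step n)
  have "redm (int l ^ k) (M (Suc n)) = redm (int l ^ k) (redm (int l ^ n) (M (Suc n)))"
    using step.hyps by (simp add: redm_redm le_imp_power_dvd)
  also have "\<dots> = M k"
    using assms(1) step by (simp add: Matl_def)
  finally show ?case .
qed

lemma Matl_redm_self: "M \<in> Matl l \<Longrightarrow> redm (int l ^ n) (M n) = M n"
  by (simp add: Matl_redm)

lemma Matl_eq_le:
  assumes "M \<in> Matl l" "M' \<in> Matl l" "M n = M' n" "k \<le> n"
  shows "M k = M' k"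
  by (metis assms Matl_redm)

lemma lmul_in_Matl: "A \<in> Matl l \<Longrightarrow> B \<in> Matl l \<Longrightarrow> lmul l A B \<in> Matl l"
  unfolding lmul_def by (rule MatlI) (rule redm_mul2_cong; simp add: Matl_redm)

lemma lid_in_Matl: "lid l \<in> Matl l"
  unfolding lid_def by (rule MatlI) simp

lemma GL2_Matl: "M \<in> GL2 l \<Longrightarrow> M \<in> Matl l"
  by (simp add: GL2_def)

locale ladic =
  fixes l :: nat
  assumes prime_l: "Factorial_Ring.prime l"
begin

lemma prime_int_l: "Factorial_Ring.prime (int l)"
  using prime_l by simp

lemma l_gt_1: "l > 1"
  using prime_l prime_gt_1_nat by blast

lemma l_nz: "int l \<noteq> 0"
  using l_gt_1 by simp

lemma coprime_power_l: "\<not> int l dvd c \<Longrightarrow> coprime c (int l ^ n)"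
  using prime_imp_coprime[OF prime_int_l] by (simp add: coprime_commute)

lemma lid_in_GL2: "lid l \<in> GL2 l"
  using l_gt_1 unfolding GL2_def by (simp add: lid_in_Matl) (simp add: lid_def id2_def)

lemma det2_GL2:
  assumes "M \<in> GL2 l" "n \<ge> 1"
  shows "\<not> int l dvd det2 (M n)"
proof -
  have "redm (int l) (M n) = redm (int l) (M 1)"
    using Matl_redm[OF GL2_Matl[OF assms(1)], of 1] assms(2) by (metis power_one_right order_refl)
  hence "det2 (M n) mod int l = det2 (M 1) mod int l" by (rule det2_redm)
  thus ?thesis using assms(1) by (simp add: GL2_def dvd_eq_mod_eq_0)
qed

lemma lmul_in_GL2:
  assumes "A \<in> GL2 l" "B \<in> GL2 l"
  shows "lmul l A B \<in> GL2 l"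
proof -
  have "det2 (lmul l A B 1) mod int l = (det2 (A 1) * det2 (B 1)) mod int l"
    unfolding lmul_def det2_mul2[symmetric] by (rule det2_redm) simp
  moreover have "\<not> int l dvd det2 (A 1) * det2 (B 1)"
    using assms prime_dvd_mult_iff[OF prime_int_l] by (simp add: GL2_def)
  ultimately show ?thesis
    using lmul_in_Matl assms unfolding GL2_def by (simp add: dvd_eq_mod_eq_0)
qed

text \<open>The determinant is a unit at every level, so a scaled adjugate is an inverse there;
  uniqueness of inverses makes the levels fit together.\<close>

lemma GL2_inverse:
  assumes "M \<in> GL2 l"
  obtains M' where "M' \<in> GL2 l" "lmul l M M' = lid l" "lmul l M' M = lid l"
proof -
  have "\<exists>F. redm (int l ^ n) (mul2 (M n) F) = redm (int l ^ n) id2 \<and>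
            redm (int l ^ n) (mul2 F (M n)) = redm (int l ^ n) id2" for n
  proof -
    have "coprime (det2 (M n)) (int l ^ n)"
      using det2_GL2[OF assms, of n] coprime_power_l[of "det2 (M n)" n] by (cases "n = 0") simp_all
    then obtain v where v: "[det2 (M n) * v = 1] (mod (int l ^ n))"
      using cong_solve_coprime_int by blast
    obtain p q r s where M: "M n = (p,q,r,s)" by (cases "M n")
    have "int l ^ n dvd p*s*v - q*r*v - 1"
      using v unfolding M cong_iff_dvd_diff by (simp add: algebra_simps)
    hence "redm (int l ^ n) (mul2 (M n) (s*v, - q*v, - r*v, p*v)) = redm (int l ^ n) id2 \<and>
           redm (int l ^ n) (mul2 (s*v, - q*v, - r*v, p*v) (M n)) = redm (int l ^ n) id2"
      unfolding M id2_def mul2.simps redm_eq_iff by (simp add: algebra_simps)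
    thus ?thesis by blast
  qed
  then obtain F where F: "\<And>n. redm (int l ^ n) (mul2 (M n) (F n)) = redm (int l ^ n) id2"
     "\<And>n. redm (int l ^ n) (mul2 (F n) (M n)) = redm (int l ^ n) id2"
    by metis
  define M' where "M' = (\<lambda>n. redm (int l ^ n) (F n))"
  have "M' \<in> Matl l"
    unfolding M'_def
  proof (rule MatlI, rule redm_inverse_unique)
    fix n
    show "redm (int l ^ n) (mul2 (M n) (F n)) = redm (int l ^ n) id2" by (rule F)
    have "redm (int l ^ n) (mul2 (F (Suc n)) (M n)) = redm (int l ^ n) (mul2 (F (Suc n)) (M (Suc n)))"
      using assms by (intro redm_mul2_cong) (simp_all add: GL2_def Matl_def)
    also have "\<dots> = redm (int l ^ n) id2"
      using F(2)[of "Suc n"] by (rule redm_cong_dvd) simp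
    finally show "redm (int l ^ n) (mul2 (F (Suc n)) (M n)) = redm (int l ^ n) id2" .
  qed
  moreover have MM': "lmul l M M' = lid l" and "lmul l M' M = lid l"
    using F by (auto simp: lmul_def lid_def M'_def)
  moreover have "\<not> int l dvd det2 (M' 1)"
  proof
    assume "int l dvd det2 (M' 1)"
    hence "int l dvd det2 (mul2 (M 1) (M' 1))" by (simp add: det2_mul2)
    moreover have "det2 (mul2 (M 1) (M' 1)) mod int l = det2 (lid l 1) mod int l"
      unfolding MM'[symmetric] lmul_def by (rule det2_redm) simp
    ultimately show False
      using lid_in_GL2 by (simp add: GL2_def dvd_eq_mod_eq_0)
  qed
  ultimately show ?thesis using that by (simp add: GL2_def)
qed

text \<open>An \<open>l\<close>-adic integer is represented by a coherent sequence of integers that need not be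
  normalised; two of them are equal in \<open>Z_l\<close> iff their difference satisfies \<open>null\<close>. This allows
  computations by ring identities in \<open>int\<close>.\<close>
definition coh :: "(nat \<Rightarrow> int) \<Rightarrow> bool" where
  "coh x \<longleftrightarrow> (\<forall>n. int l ^ n dvd x (Suc n) - x n)"

definition null :: "(nat \<Rightarrow> int) \<Rightarrow> bool" where
  "null x \<longleftrightarrow> (\<forall>n. int l ^ n dvd x n)"

lemma nullD: "null x \<Longrightarrow> int l ^ n dvd x n"
  by (simp add: null_def)

lemma coh_const [simp]: "coh (\<lambda>n. c)"
  by (simp add: coh_def)

lemma coh_add [simp]: "coh x \<Longrightarrow> coh y \<Longrightarrow> coh (\<lambda>n. x n + y n)"
  unfolding coh_def by (metis add_diff_add dvd_add)

lemma coh_minus [simp]: "coh x \<Longrightarrow> coh (\<lambda>n. - x n)"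
  unfolding coh_def by (metis dvd_minus_iff minus_diff_minus)

lemma coh_diff [simp]: "coh x \<Longrightarrow> coh y \<Longrightarrow> coh (\<lambda>n. x n - y n)"
  using coh_add[OF _ coh_minus[of y]] by simp

lemma coh_mult [simp]:
  assumes "coh x" "coh y" shows "coh (\<lambda>n. x n * y n)"
  unfolding coh_def
proof
  fix n
  have "x (Suc n) * y (Suc n) - x n * y n = (x (Suc n) - x n) * y (Suc n) + x n * (y (Suc n) - y n)"
    by (simp add: algebra_simps)
  thus "int l ^ n dvd x (Suc n) * y (Suc n) - x n * y n"
    using assms unfolding coh_def by (metis dvd_add dvd_mult dvd_mult2)
qed

lemma coh_power2 [simp]: "coh x \<Longrightarrow> coh (\<lambda>n. (x n)\<^sup>2)"
  by (simp add: power2_eq_square)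

lemma coh_le:
  assumes "coh x" "k \<le> n"
  shows "int l ^ k dvd x n - x k"
  using assms(2)
proof (induction n rule: dec_induct)
  case base then show ?case by simp
next
  case (step n)
  have "int l ^ k dvd x (Suc n) - x n"
    using assms(1) step(1) unfolding coh_def by (meson dvd_trans le_imp_power_dvd)
  with step show ?case using dvd_add[of "int l ^ k" "x n - x k" "x (Suc n) - x n"] by simp
qed

lemma coh_dvd_iff:
  assumes "coh x" "j \<le> k" "k \<le> n"
  shows "int l ^ j dvd x n \<longleftrightarrow> int l ^ j dvd x k"
proof -
  have "int l ^ j dvd x n - x k"
    using coh_le[OF assms(1,3)] assms(2) by (meson dvd_trans le_imp_power_dvd)
  thus ?thesis using dvd_add_right_iff[of "int l ^ j" "x n - x k" "x k"] by simp
qed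

text \<open>Z_l is a domain: if x has fewer than i factors l and y fewer than j, then their product
  cannot have i + j - 1 of them.\<close>

lemma null_mult:
  assumes "coh x" "coh y" "null (\<lambda>n. x n * y n)"
  shows "null x \<or> null y"
proof (rule ccontr)
  assume "\<not> (null x \<or> null y)"
  then obtain i j where ij: "\<not> int l ^ i dvd x i" "\<not> int l ^ j dvd y j"
    by (auto simp: null_def)
  have "\<not> int l ^ i dvd x (i + j)" "\<not> int l ^ j dvd y (i + j)"
    using ij coh_dvd_iff[OF assms(1), of i i "i+j"] coh_dvd_iff[OF assms(2), of j j "i+j"] by auto
  \<comment> \<open>This guards the truncated subtraction in \<open>i + j - 1\<close>.\<close>
  moreover have "i + j > 0" using ij by (cases "i = 0") auto
  moreover have "int l ^ (i + j - 1) dvd x (i + j) * y (i + j)"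
    using nullD[OF assms(3), of "i + j"] by (meson diff_le_self dvd_trans le_imp_power_dvd)
  ultimately show False
    using prime_elem_power_dvd_cases[of "int l" "i + j - 1" "x (i+j)" "y (i+j)" i j] prime_int_l
    by auto
qed

lemma null_const: "null (\<lambda>n. c) \<longleftrightarrow> c = 0"
proof
  assume *: "null (\<lambda>n. c)"
  show "c = 0"
  proof (rule ccontr)
    assume "c \<noteq> 0"
    \<comment> \<open>The level \<open>nat \<bar>c\<bar>\<close> is high enough because
      \<open>l ^ m > m\<close>.\<close>
    have "int l ^ nat \<bar>c\<bar> \<le> \<bar>c\<bar>"
      using nullD[OF *, of "nat \<bar>c\<bar>"] \<open>c \<noteq> 0\<close> dvd_imp_le_int[of c "int l ^ nat \<bar>c\<bar>"] by simp
    moreover have "int (nat \<bar>c\<bar>) < int (l ^ nat \<bar>c\<bar>)"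
      using l_gt_1 power_gt_expt[of l "nat \<bar>c\<bar>"] by linarith
    ultimately show False by simp
  qed
qed (simp add: null_def)

text \<open>Z_l is torsion-free, so the factors 2 and l that appear below can be cancelled,
  including 2 when l = 2.\<close>

lemma null_cmult:
  assumes "coh x" "c \<noteq> 0" "null (\<lambda>n. c * x n)"
  shows "null x"
  using null_mult[of "\<lambda>n. c" x] assms null_const by auto

lemma Zl_coh: "x \<in> Zl l \<Longrightarrow> coh x"
  unfolding Zl_def coh_def by (metis (mono_tags, lifting) mem_Collect_eq dvd_minus_mod)

lemma coh_mod_Zl:
  assumes "coh x" shows "(\<lambda>n. x n mod int l ^ n) \<in> Zl l"
proof -
  have "x (Suc n) mod int l ^ n = x n mod int l ^ n" for n
    using assms by (simp add: coh_def mod_eq_dvd_iff)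
  thus ?thesis using l_gt_1 by (simp add: Zl_def mod_mod_cancel)
qed

lemma Matl_cohE:
  assumes "M \<in> Matl l"
  obtains p q r s where "\<And>n. M n = (p n, q n, r n, s n)" "coh p" "coh q" "coh r" "coh s"
proof -
  have "\<exists>p q r s. \<forall>n. M n = (p n, q n, r n, s n)"
    by (rule exI[of _ "\<lambda>n. fst (M n)"], rule exI[of _ "\<lambda>n. fst (snd (M n))"],
        rule exI[of _ "\<lambda>n. fst (snd (snd (M n)))"], rule exI[of _ "\<lambda>n. snd (snd (snd (M n)))"]) simp
  then obtain p q r s where *: "\<And>n. M n = (p n, q n, r n, s n)" by metis
  have "redm (int l ^ n) (M (Suc n)) = redm (int l ^ n) (M n)" for n
    using assms by (simp add: Matl_def)
  hence "coh p" "coh q" "coh r" "coh s"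
    unfolding * redm_eq_iff coh_def by auto
  with * show ?thesis using that by blast
qed

end

text \<open>A product is already reduced, so the identity is absorbed without assuming that the
  factors lie in \<open>Matl\<close>.\<close>

lemma lmul_lid_absorb [simp]:
  "lmul l (lid l) (lmul l A B) = lmul l A B"
  "lmul l (lmul l A B) (lid l) = lmul l A B"
  "lmul l A (lmul l (lid l) B) = lmul l A B"
  "lmul l A (lmul l B (lid l)) = lmul l A B"
  by (simp_all add: lmul_def lid_def)

text \<open>If a matrix \<open>(p,q,r,s)\<close> conjugates \<open>1 + ew\<close> into \<open>1 + x + yw\<close>, where
  \<open>w\<^sup>2 = tw - d\<close>, comparing traces, determinants and hence discriminants of
  \<open>ew\<close> and \<open>x + yw\<close> gives the last two relations.\<close>
lemma conj_relations:
  fixes m e t d x y p q r s :: int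
  assumes "redm m (mul2 (p,q,r,s) (1, -(d*e), e, 1 + t*e)) =
           redm m (mul2 (1 + x, -(d*y), y, 1 + x + t*y) (p,q,r,s))"
    and "coprime (p*s - q*r) m"
  shows "m dvd e*q - x*p + d*y*r" "m dvd e*s - y*p - x*r - t*y*r"
    and "m dvd e*t - 2*x - t*y"
    and "m dvd (t^2 - 4*d) * ((e - y) * (e + y))"
proof -
  have E: "m dvd e*q - x*p + d*y*r" "m dvd e*(t*q-d*p) - x*q + d*y*s"
    "m dvd e*s - y*p - x*r - t*y*r" "m dvd e*(t*s-d*r) - y*q - x*s - t*y*s"
    using assms(1) unfolding mul2.simps redm_eq_iff by (simp_all add: algebra_simps)
  show "m dvd e*q - x*p + d*y*r" "m dvd e*s - y*p - x*r - t*y*r" by (rule E)+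
  \<comment> \<open>With E the difference of the two sides of the matrix relation, this is the trace
    of E times the adjugate of \<open>(p,q,r,s)\<close>.\<close>
  have "(e*t - 2*x - t*y) * (p*s - q*r) = (e*q - x*p + d*y*r) * s - (e*(t*q-d*p) - x*q + d*y*s) * r
     - (e*s - y*p - x*r - t*y*r) * q + (e*(t*s-d*r) - y*q - x*s - t*y*s) * p"
    by (simp add: algebra_simps)
  also have "m dvd \<dots>"
    by (intro dvd_add dvd_diff dvd_mult2 E)
  finally show T: "m dvd e*t - 2*x - t*y"
    using assms(2) by (simp add: coprime_dvd_mult_left_iff coprime_commute)
  \<comment> \<open>Subtracting \<open>(p,q,r,s)\<close> from both sides of the matrix relation
    leaves congruent matrices; the difference of their determinants is expanded in the four entries
    of E.\<close>
  have "(e^2*d - (x^2 + t*x*y + d*y^2)) * (p*s - q*r) =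
     (e*q - x*p + d*y*r) * (e*(t*s-d*r)) + (e*(t*s-d*r) - y*q - x*s - t*y*s) * (x*p - d*y*r)
     - (e*(t*q-d*p) - x*q + d*y*s) * (e*s) - (e*s - y*p - x*r - t*y*r) * (x*q - d*y*s)"
    by (simp add: algebra_simps power2_eq_square)
  also have "m dvd \<dots>"
    by (intro dvd_add dvd_diff dvd_mult2 E)
  finally have D: "m dvd e^2*d - (x^2 + t*x*y + d*y^2)"
    using assms(2) by (simp add: coprime_dvd_mult_left_iff coprime_commute)
  have "(t^2 - 4*d) * ((e - y) * (e + y)) = (e*t - 2*x - t*y) * (e*t + 2*x + t*y)
     - (e^2*d - (x^2 + t*x*y + d*y^2)) * 4"
    by (simp add: algebra_simps power2_eq_square)
  also have "m dvd \<dots>"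
    by (intro dvd_diff dvd_mult2 T D)
  finally show "m dvd (t^2 - 4*d) * ((e - y) * (e + y))" .
qed

subsection \<open>The normalizer of a Cartan subgroup\<close>

locale cartan = ladic +
  fixes t d :: "nat \<Rightarrow> int" and P Q :: "nat \<Rightarrow> mat2"
  assumes coh_t: "coh t" and coh_d: "coh d"
    and disc_nz: "\<not> null (\<lambda>n. (t n)\<^sup>2 - 4 * d n)"
    and ram: "int l dvd (t 1)\<^sup>2 - 4 * d 1"
    and P: "P \<in> GL2 l" and Q: "Q \<in> GL2 l"
    and PQ: "lmul l P Q = lid l" and QP: "lmul l Q P = lid l"
begin

definition ct :: "nat \<Rightarrow> int \<Rightarrow> int \<Rightarrow> mat2" where
  "ct n x y = (x, - (d n * y), y, x + t n * y)"

text \<open>Multiplication by \<open>x + yw\<close> composed with the conjugation \<open>w \<mapsto> t - w\<close>.\<close>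
definition tw :: "nat \<Rightarrow> int \<Rightarrow> int \<Rightarrow> mat2" where
  "tw n x y = (x, t n * x + d n * y, y, - x)"

definition nm :: "nat \<Rightarrow> int \<Rightarrow> int \<Rightarrow> int" where
  "nm n x y = x\<^sup>2 + t n * x * y + d n * y\<^sup>2"

text \<open>The change from the basis (1, w) to the given basis. The argument may consist of
  unreduced matrices, since the products reduce it.\<close>

definition cj :: "(nat \<Rightarrow> mat2) \<Rightarrow> nat \<Rightarrow> mat2" where
  "cj F = lmul l P (lmul l F Q)"

lemma det2_ct: "det2 (ct n x y) = nm n x y"
  by (simp add: ct_def nm_def algebra_simps power2_eq_square)

lemma det2_tw: "det2 (tw n x y) = - nm n x y"
  by (simp add: tw_def nm_def algebra_simps power2_eq_square)

lemma cj_apply: "cj F n = redm (int l ^ n) (mul2 (P n) (mul2 (F n) (Q n)))"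
  by (simp add: cj_def lmul_def)

lemma PQ_cancel: "lmul l P (lmul l Q A) = lmul l (lid l) A" "lmul l Q (lmul l P A) = lmul l (lid l) A"
  by (simp_all add: lmul_assoc[symmetric] PQ QP)

lemma cj_inverse: "lmul l Q (lmul l (cj F) P) = (\<lambda>n. redm (int l ^ n) (F n))"
proof -
  have "lmul l Q (lmul l (cj F) P) = lmul l (lid l) (lmul l F (lid l))"
    by (simp add: cj_def lmul_assoc PQ_cancel QP)
  also have "\<dots> = (\<lambda>n. redm (int l ^ n) (F n))"
    by (simp add: lmul_def lid_def)
  finally show ?thesis .
qed

lemma cj_of_inverse: "M \<in> Matl l \<Longrightarrow> cj (lmul l Q (lmul l M P)) = M"
  by (simp add: cj_def lmul_assoc PQ PQ_cancel lmul_lid)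

lemma redm_PQ: "redm (int l ^ n) (mul2 (P n) (Q n)) = redm (int l ^ n) id2"
   "redm (int l ^ n) (mul2 (Q n) (P n)) = redm (int l ^ n) id2"
  using fun_cong[OF PQ, of n] fun_cong[OF QP, of n] by (simp_all add: lmul_def lid_def)

text \<open>P and Q are inverse to each other modulo every power of l, so congruences can be tested
  in the basis (1, w).\<close>

lemma redm_cj_eq_iff:
  assumes "k \<le> n"
  shows "redm (int l ^ k) (cj F n) = redm (int l ^ k) (cj Y n) \<longleftrightarrow>
         redm (int l ^ k) (F n) = redm (int l ^ k) (Y n)" (is "?L \<longleftrightarrow> ?R")
proof
  have det_dvd: "int l ^ k dvd int l ^ n" using assms by (simp add: le_imp_power_dvd)
  have *: "redm (int l ^ k) (mul2 (Q n) (mul2 (cj Z n) (P n))) = redm (int l ^ k) (Z n)" for Z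
  proof (rule redm_cong_dvd[OF _ det_dvd])
    show "redm (int l ^ n) (mul2 (Q n) (mul2 (cj Z n) (P n))) = redm (int l ^ n) (Z n)"
      using fun_cong[OF cj_inverse[of Z], of n] by (simp only: lmul_def redm_mul2)
  qed
  assume ?L
  hence "redm (int l ^ k) (mul2 (Q n) (mul2 (cj F n) (P n))) = redm (int l ^ k) (mul2 (Q n) (mul2 (cj Y n) (P n)))"
    by (intro redm_mul2_cong refl)
  thus ?R by (simp only: *)
next
  have det_dvd: "int l ^ k dvd int l ^ n" using assms by (simp add: le_imp_power_dvd)
  assume ?R
  thus ?L unfolding cj_apply redm_redm[OF det_dvd] by (intro redm_mul2_cong refl)
qed

lemma cj_eq_iff: "cj F n = cj Y n \<longleftrightarrow> redm (int l ^ n) (F n) = redm (int l ^ n) (Y n)"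
  using redm_cj_eq_iff[OF order_refl, of n F Y] by (simp only: cj_apply redm_idem)

lemma det2_cj: "det2 (cj F n) mod int l ^ n = det2 (F n) mod int l ^ n"
proof -
  have "det2 (mul2 (P n) (Q n)) mod int l ^ n = 1 mod int l ^ n"
    using det2_redm[OF redm_PQ(1)] by (simp add: id2_def)
  hence "(det2 (F n) * (det2 (P n) * det2 (Q n))) mod int l ^ n = (det2 (F n) * 1) mod int l ^ n"
    unfolding det2_mul2 by (rule mod_mult_cong[OF refl])
  also have "det2 (F n) * (det2 (P n) * det2 (Q n)) = det2 (mul2 (P n) (mul2 (F n) (Q n)))"
    by (simp only: det2_mul2 mult_ac)
  also have "\<dots> mod int l ^ n = det2 (cj F n) mod int l ^ n"
    unfolding cj_apply by (rule det2_redm) (simp only: redm_idem)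
  finally show ?thesis by (simp only: mult_1_right)
qed

lemma cj_in_Matl:
  assumes "\<And>n. redm (int l ^ n) (F (Suc n)) = redm (int l ^ n) (F n)"
  shows "cj F \<in> Matl l"
proof -
  have "cj F = (\<lambda>n. redm (int l ^ n) (mul2 (P n) (mul2 (F n) (Q n))))"
    by (rule ext) (rule cj_apply)
  also have "\<dots> \<in> Matl l"
    using P Q assms by (intro MatlI redm_mul2_cong) (simp_all add: GL2_def Matl_def)
  finally show ?thesis .
qed

lemma cj_in_GL2_iff:
  assumes "\<And>n. redm (int l ^ n) (F (Suc n)) = redm (int l ^ n) (F n)"
  shows "cj F \<in> GL2 l \<longleftrightarrow> \<not> int l dvd det2 (F 1)"
  using cj_in_Matl[OF assms] det2_cj[of F 1] by (simp add: GL2_def dvd_eq_mod_eq_0)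

lemma ct_coherent:
  assumes "coh x" "coh y"
  shows "redm (int l ^ n) (ct (Suc n) (x (Suc n)) (y (Suc n))) = redm (int l ^ n) (ct n (x n) (y n))"
  using coh_minus[OF coh_mult[OF coh_d assms(2)]] coh_add[OF assms(1) coh_mult[OF coh_t assms(2)]] assms
  unfolding ct_def redm_eq_iff coh_def by simp

lemma tw_coherent:
  assumes "coh x" "coh y"
  shows "redm (int l ^ n) (tw (Suc n) (x (Suc n)) (y (Suc n))) = redm (int l ^ n) (tw n (x n) (y n))"
  using coh_minus[OF assms(1)] coh_add[OF coh_mult[OF coh_t assms(1)] coh_mult[OF coh_d assms(2)]] assms
  unfolding tw_def redm_eq_iff coh_def by simp

definition cart :: "(nat \<Rightarrow> mat2) set" where
  "cart = {M \<in> GL2 l. \<exists>x y. coh x \<and> coh y \<and> M = cj (\<lambda>n. ct n (x n) (y n))}"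

definition twist :: "(nat \<Rightarrow> mat2) set" where
  "twist = {M \<in> GL2 l. \<exists>x y. coh x \<and> coh y \<and> M = cj (\<lambda>n. tw n (x n) (y n))}"

lemma cartI: "coh x \<Longrightarrow> coh y \<Longrightarrow> cj (\<lambda>n. ct n (x n) (y n)) \<in> GL2 l \<Longrightarrow> cj (\<lambda>n. ct n (x n) (y n)) \<in> cart"
  unfolding cart_def by (intro CollectI conjI exI[of _ x] exI[of _ y] refl)

lemma twistI: "coh x \<Longrightarrow> coh y \<Longrightarrow> cj (\<lambda>n. tw n (x n) (y n)) \<in> GL2 l \<Longrightarrow> cj (\<lambda>n. tw n (x n) (y n)) \<in> twist"
  unfolding twist_def by (intro CollectI conjI exI[of _ x] exI[of _ y] refl)

lemma cartE:
  assumes "M \<in> cart"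
  obtains x y where "M \<in> GL2 l" "coh x" "coh y" "M = cj (\<lambda>n. ct n (x n) (y n))"
proof -
  have "M \<in> GL2 l" "\<exists>x y. coh x \<and> coh y \<and> M = cj (\<lambda>n. ct n (x n) (y n))"
    using assms unfolding cart_def mem_Collect_eq by (rule conjunct1, rule conjunct2)
  thus ?thesis using that by (elim exE conjE)
qed

lemma twistE:
  assumes "M \<in> twist"
  obtains x y where "M \<in> GL2 l" "coh x" "coh y" "M = cj (\<lambda>n. tw n (x n) (y n))"
proof -
  have "M \<in> GL2 l" "\<exists>x y. coh x \<and> coh y \<and> M = cj (\<lambda>n. tw n (x n) (y n))"
    using assms unfolding twist_def mem_Collect_eq by (rule conjunct1, rule conjunct2)
  thus ?thesis using that by (elim exE conjE)
qed

text \<open>Passes from coordinates in \<open>Zl\<close> to arbitrary coherent ones: reducing the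
  coordinates modulo \<open>l ^ n\<close> does not change the reduced matrix.\<close>

lemma std_cartan_conj: "cart = (\<lambda>A. lmul l P (lmul l A Q)) ` std_cartan l t d"
proof (intro equalityI subsetI)
  fix M assume "M \<in> cart"
  then obtain x y where M: "M \<in> GL2 l" "coh x" "coh y" "M = cj (\<lambda>n. ct n (x n) (y n))"
    by (rule cartE)
  define A where "A = lmul l Q (lmul l M P)"
  have "A \<in> GL2 l" unfolding A_def using M(1) P Q by (intro lmul_in_GL2)
  moreover have "A n = redm (int l ^ n) (x n mod int l ^ n, - (d n * (y n mod int l ^ n)), y n mod int l ^ n,
        x n mod int l ^ n + t n * (y n mod int l ^ n))" for n
    unfolding A_def M(4) cj_inverse ct_def redm_eq_iff
    by (simp add: minus_mult_div_eq_mod [symmetric] algebra_simps)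
  ultimately have "A \<in> std_cartan l t d"
    unfolding std_cartan_def
    by (intro CollectI conjI bexI[OF _ coh_mod_Zl[OF M(2)]] bexI[OF _ coh_mod_Zl[OF M(3)]] allI)
  moreover have "M = lmul l P (lmul l A Q)"
    using cj_of_inverse[OF GL2_Matl[OF M(1)]] by (simp add: A_def cj_def)
  ultimately show "M \<in> (\<lambda>A. lmul l P (lmul l A Q)) ` std_cartan l t d" by blast
next
  fix M assume "M \<in> (\<lambda>A. lmul l P (lmul l A Q)) ` std_cartan l t d"
  then obtain A where "A \<in> std_cartan l t d" and A: "M = cj A"
    unfolding cj_def by blast
  then obtain x y where xy: "x \<in> Zl l" "y \<in> Zl l"
    and Axy: "\<forall>n. A n = redm (int l ^ n) (x n, - (d n * y n), y n, x n + t n * y n)" and AG: "A \<in> GL2 l"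
    unfolding std_cartan_def by (elim CollectE conjE bexE)
  have "A = (\<lambda>n. redm (int l ^ n) (ct n (x n) (y n)))"
    by (rule ext) (unfold ct_def, rule Axy[rule_format])
  hence "M = cj (\<lambda>n. ct n (x n) (y n))"
    unfolding A by (subst \<open>A = _\<close>, intro ext) (simp add: cj_eq_iff)
  moreover have "M \<in> GL2 l" unfolding A cj_def using AG P Q by (intro lmul_in_GL2)
  ultimately show "M \<in> cart" using cartI[OF Zl_coh Zl_coh] xy by simp
qed

text \<open>A common element satisfies 2x + ty = 0 and tx + 2dy = 0. Up to sign, the determinant of
  this linear system is the nonzero discriminant, so x = y = 0, which contradicts
  invertibility.\<close>

lemma cart_twist_disjoint: "cart \<inter> twist = {}"
proof (rule equals0I)
  fix M assume "M \<in> cart \<inter> twist"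
  then obtain x y x' y' where M: "M \<in> GL2 l" and coh: "coh x" "coh y" "coh x'" "coh y'"
    and eq: "M = cj (\<lambda>n. tw n (x n) (y n))" "M = cj (\<lambda>n. ct n (x' n) (y' n))"
    by (elim IntE cartE twistE)
  have "redm (int l ^ n) (tw n (x n) (y n)) = redm (int l ^ n) (ct n (x' n) (y' n))" for n
    using eq cj_eq_iff[of "\<lambda>n. tw n (x n) (y n)" n "\<lambda>n. ct n (x' n) (y' n)"] by metis
  hence E: "int l ^ n dvd x n - x' n" "int l ^ n dvd t n * x n + d n * y n - - (d n * y' n)"
      "int l ^ n dvd y n - y' n" "int l ^ n dvd - x n - (x' n + t n * y' n)" for n
    unfolding tw_def ct_def redm_eq_iff by blast+
  have "int l ^ n dvd 2 * x n + t n * y n" for n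
  proof -
    have eqn: "2 * x n + t n * y n = (x n - x' n) + (y n - y' n) * t n - (- x n - (x' n + t n * y' n))"
      by (simp add: algebra_simps)
    show ?thesis by (subst eqn) (intro E dvd_add dvd_diff dvd_mult2)
  qed
  note tr = this
  have "int l ^ n dvd ((t n)\<^sup>2 - 4 * d n) * y n" for n
  proof -
    have eqn: "((t n)\<^sup>2 - 4 * d n) * y n = (2 * x n + t n * y n) * t n
        - (t n * x n + d n * y n - - (d n * y' n)) * 2 - (y n - y' n) * (2 * d n)"
      by (simp add: algebra_simps power2_eq_square)
    show ?thesis by (subst eqn) (intro E tr dvd_diff dvd_mult2)
  qed
  hence "null (\<lambda>n. ((t n)\<^sup>2 - 4 * d n) * y n)" by (simp add: null_def)
  hence y: "null y"
    using null_mult[of "\<lambda>n. (t n)\<^sup>2 - 4 * d n" y] disc_nz coh coh_t coh_d by auto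
  have "null (\<lambda>n. 2 * x n)"
    unfolding null_def using tr nullD[OF y] by (metis dvd_add_left_iff dvd_mult)
  hence x: "null x" using coh by (intro null_cmult[of x 2]) auto
  have "int l dvd nm 1 (x 1) (y 1)"
    using nullD[OF x, of 1] nullD[OF y, of 1] by (simp add: nm_def power2_eq_square)
  moreover have "\<not> int l dvd det2 (tw 1 (x 1) (y 1))"
    using M cj_in_GL2_iff[OF tw_coherent[OF coh(1,2)]] eq(1) by simp
  ultimately show False by (simp add: det2_tw)
qed

text \<open>Moving the conjugation past a multiplication conjugates the multiplier: x' + ty' - y'w
  is the conjugate of x' + y'w.\<close>

lemma tw_ct_commute:
  "mul2 (tw n x y) (ct n x' y') = mul2 (ct n (x' + t n * y') (- y')) (tw n x y)"
  by (simp add: ct_def tw_def algebra_simps)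

lemma lmul_cj: "lmul l (cj F) (cj Y) = cj (\<lambda>n. mul2 (F n) (Y n))"
proof -
  have "lmul l (cj F) (cj Y) = lmul l P (lmul l (lmul l F Y) Q)"
    by (simp add: cj_def lmul_assoc PQ_cancel)
  also have "\<dots> = cj (\<lambda>n. mul2 (F n) (Y n))"
    by (simp add: cj_def) (simp add: lmul_def)
  finally show ?thesis .
qed

text \<open>Conjugating by a twisted element acts on the Cartan subgroup as the conjugation
  \<open>bar\<close> of the quadratic ring. It preserves norms, which gives one inclusion, and is an
  involution, which gives the other.\<close>

lemma twist_conj_cart:
  assumes "M \<in> twist" "M' \<in> GL2 l" "lmul l M M' = lid l"
  shows "(\<lambda>h. lmul l M (lmul l h M')) ` cart = cart"
proof -
  obtain x y where M: "coh x" "coh y" "M = cj (\<lambda>n. tw n (x n) (y n))"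
    using assms(1) by (rule twistE)
  define bar where "bar u v = cj (\<lambda>n. ct n (u n + t n * v n) (- v n))" for u v :: "nat \<Rightarrow> int"
  have conj: "lmul l M (lmul l (cj (\<lambda>n. ct n (u n) (v n))) M') = bar u v" if "coh u" "coh v" for u v
  proof -
    have "lmul l M (cj (\<lambda>n. ct n (u n) (v n))) = lmul l (bar u v) M"
      unfolding M(3) bar_def lmul_cj tw_ct_commute ..
    hence "lmul l M (lmul l (cj (\<lambda>n. ct n (u n) (v n))) M') = lmul l (bar u v) (lid l)"
      by (metis assms(3) lmul_assoc)
    also have "\<dots> = bar u v"
      by (simp add: bar_def cj_def lmul_assoc)
    finally show ?thesis .
  qed
  have nm_bar: "nm n (u + t n * v) (- v) = nm n u v" for n u v
    by (simp add: nm_def algebra_simps power2_eq_square)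
  have bar: "bar u v \<in> cart" if "coh u" "coh v" "cj (\<lambda>n. ct n (u n) (v n)) \<in> GL2 l" for u v
  proof -
    have "coh (\<lambda>n. u n + t n * v n)" "coh (\<lambda>n. - v n)" using that coh_t by auto
    moreover have "bar u v \<in> GL2 l"
      using that(3) cj_in_GL2_iff[OF ct_coherent[OF that(1,2)]]
        cj_in_GL2_iff[OF ct_coherent[OF calculation]]
      unfolding bar_def det2_ct nm_bar by blast
    ultimately show ?thesis unfolding bar_def by (intro cartI)
  qed
  show ?thesis
  proof (intro equalityI subsetI)
    fix h assume "h \<in> (\<lambda>h. lmul l M (lmul l h M')) ` cart"
    then obtain k where k: "k \<in> cart" "h = lmul l M (lmul l k M')" by blast
    from k(1) obtain u v where uv: "k \<in> GL2 l" "coh u" "coh v" "k = cj (\<lambda>n. ct n (u n) (v n))"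
      by (rule cartE)
    have "h = bar u v" unfolding k(2) uv(4) by (rule conj[OF uv(2,3)])
    thus "h \<in> cart" using bar[OF uv(2,3)] uv(1) unfolding uv(4) by simp
  next
    fix h assume "h \<in> cart"
    then obtain u v where h: "h \<in> GL2 l" "coh u" "coh v" "h = cj (\<lambda>n. ct n (u n) (v n))"
      by (rule cartE)
    have "coh (\<lambda>n. u n + t n * v n)" "coh (\<lambda>n. - v n)" using h coh_t by auto
    hence "lmul l M (lmul l (bar u v) M') = bar (\<lambda>n. u n + t n * v n) (\<lambda>n. - v n)"
      unfolding bar_def[of u v] by (rule conj)
    also have "\<dots> = h" by (simp add: bar_def h(4))
    finally have "h = lmul l M (lmul l (bar u v) M')" ..
    moreover have "bar u v \<in> cart" using bar[OF h(2,3)] h(1) unfolding h(4) .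
    ultimately show "h \<in> (\<lambda>h. lmul l M (lmul l h M')) ` cart" by (rule image_eqI)
  qed
qed

text \<open>The test element is 1 + lw because w itself need not be a unit. The price is a factor l
  in the resulting relations, which torsion-freeness removes.\<close>

lemma normalizer_cases:
  assumes "M \<in> normalizer l cart"
  shows "M \<in> cart \<union> twist"
proof -
  obtain M' where M: "M \<in> GL2 l" and M': "M' \<in> GL2 l" "lmul l M M' = lid l" "lmul l M' M = lid l"
    and img: "(\<lambda>h. lmul l M (lmul l h M')) ` cart = cart"
    using assms by (auto simp: normalizer_def)
  have "\<not> int l dvd 1 + t 1 * int l + d 1 * (int l)\<^sup>2"
  proof
    assume "int l dvd 1 + t 1 * int l + d 1 * (int l)\<^sup>2"
    moreover have "int l dvd t 1 * int l + d 1 * (int l)\<^sup>2" by simp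
    ultimately have "int l dvd 1" by (metis add.assoc dvd_add_left_iff)
    thus False using l_gt_1 by simp
  qed
  hence "cj (\<lambda>n. ct n 1 (int l)) \<in> GL2 l"
    using cj_in_GL2_iff[OF ct_coherent[of "\<lambda>n. 1" "\<lambda>n. int l"]] by (simp add: det2_ct nm_def)
  hence H: "cj (\<lambda>n. ct n 1 (int l)) \<in> cart"
    by (rule cartI[OF coh_const coh_const])
  hence "lmul l M (lmul l (cj (\<lambda>n. ct n 1 (int l))) M') \<in> cart" using img by blast
  then obtain x y where xy: "coh x" "coh y"
    and F: "lmul l M (lmul l (cj (\<lambda>n. ct n 1 (int l))) M') = cj (\<lambda>n. ct n (x n) (y n))"
    by (rule cartE)
  \<comment> \<open>The matrix of M in the basis (1, w).\<close>
  define K where "K = lmul l Q (lmul l M P)"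
  have KM: "M = cj K" using cj_of_inverse[OF GL2_Matl[OF M]] by (simp add: K_def)
  have K_GL2: "K \<in> GL2 l" unfolding K_def using M P Q by (intro lmul_in_GL2)
  have "lmul l M (cj (\<lambda>n. ct n 1 (int l))) = lmul l (cj (\<lambda>n. ct n (x n) (y n))) M"
    by (simp add: F[symmetric] lmul_assoc M'(3))
  hence "cj (\<lambda>n. mul2 (K n) (ct n 1 (int l))) = cj (\<lambda>n. mul2 (ct n (x n) (y n)) (K n))"
    by (simp add: KM lmul_cj)
  hence rel: "redm (int l ^ n) (mul2 (K n) (ct n 1 (int l))) = redm (int l ^ n) (mul2 (ct n (x n) (y n)) (K n))" for n
    using cj_eq_iff[of "\<lambda>n. mul2 (K n) (ct n 1 (int l))" n "\<lambda>n. mul2 (ct n (x n) (y n)) (K n)"] by metis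
  obtain p q r s where K: "\<And>n. K n = (p n, q n, r n, s n)" and coh: "coh p" "coh q" "coh r" "coh s"
    using Matl_cohE[OF GL2_Matl[OF K_GL2]] by metis
  \<comment> \<open>\<open>conj_relations\<close> takes the first coordinate of the conjugate in the
    form 1 + x.\<close>
  define z where "z n = x n - 1" for n
  have xz: "x n = 1 + z n" for n by (simp add: z_def)
  have cohz: "coh z" unfolding z_def using xy by simp
  have cop: "coprime (p n * s n - q n * r n) (int l ^ n)" for n
    using det2_GL2[OF K_GL2, of n] coprime_power_l[of "p n * s n - q n * r n" n] K[of n]
    by (cases "n = 0") simp_all
  have "redm (int l ^ n) (mul2 (p n, q n, r n, s n) (1, - (d n * int l), int l, 1 + t n * int l)) =
        redm (int l ^ n) (mul2 (1 + z n, - (d n * y n), y n, 1 + z n + t n * y n) (p n, q n, r n, s n))" for n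
    using rel[of n] unfolding K ct_def xz .
  note R = conj_relations[OF this cop]
  have "null (\<lambda>n. ((t n)\<^sup>2 - 4 * d n) * ((int l - y n) * (int l + y n)))"
    using R(4) by (simp add: null_def)
  hence "null (\<lambda>n. (int l - y n) * (int l + y n))"
    using null_mult[of "\<lambda>n. (t n)\<^sup>2 - 4 * d n" "\<lambda>n. (int l - y n) * (int l + y n)"] disc_nz coh_t coh_d xy by auto
  hence "null (\<lambda>n. int l - y n) \<or> null (\<lambda>n. int l + y n)"
    using xy by (intro null_mult) auto
  thus ?thesis
  proof
    \<comment> \<open>In this case 1 + lw is mapped to itself. Then K commutes with w, so it is
      multiplication by the element in its first column \<open>(p, r)\<close>.\<close>
    assume y: "null (\<lambda>n. int l - y n)"
    have "int l ^ n dvd 2 * z n" for n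
    proof -
      have eqn: "2 * z n = (int l - y n) * t n - (int l * t n - 2 * z n - t n * y n)" by (simp add: algebra_simps)
      show ?thesis by (subst eqn) (intro R(3) nullD[OF y] dvd_diff dvd_mult2)
    qed
    hence "null (\<lambda>n. 2 * z n)" by (simp add: null_def)
    hence z: "null z" using cohz by (intro null_cmult[of z 2]) auto
    have "int l ^ n dvd int l * (q n + d n * r n)" for n
    proof -
      have eqn: "int l * (q n + d n * r n) = (int l * q n - z n * p n + d n * y n * r n) + z n * p n
          + (int l - y n) * (d n * r n)" by (simp add: algebra_simps)
      show ?thesis by (subst eqn) (intro R(1) nullD[OF y] nullD[OF z] dvd_add dvd_mult2)
    qed
    hence "null (\<lambda>n. int l * (q n + d n * r n))" by (simp add: null_def)
    hence q: "null (\<lambda>n. q n + d n * r n)"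
      using coh coh_d l_nz by (intro null_cmult[of "\<lambda>n. q n + d n * r n" "int l"]) auto
    have "int l ^ n dvd int l * (s n - p n - t n * r n)" for n
    proof -
      have eqn: "int l * (s n - p n - t n * r n) = (int l * s n - y n * p n - z n * r n - t n * y n * r n)
          - (int l - y n) * (p n + t n * r n) + z n * r n" by (simp add: algebra_simps)
      show ?thesis by (subst eqn) (intro R(2) nullD[OF y] nullD[OF z] dvd_add dvd_diff dvd_mult2)
    qed
    hence "null (\<lambda>n. int l * (s n - p n - t n * r n))" by (simp add: null_def)
    hence s: "null (\<lambda>n. s n - p n - t n * r n)"
      using coh coh_t l_nz by (intro null_cmult[of "\<lambda>n. s n - p n - t n * r n" "int l"]) auto
    have "redm (int l ^ n) (K n) = redm (int l ^ n) (ct n (p n) (r n))" for n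
      unfolding K ct_def redm_eq_iff using nullD[OF q, of n] nullD[OF s, of n] by (simp add: algebra_simps)
    hence "M = cj (\<lambda>n. ct n (p n) (r n))"
      unfolding KM using cj_eq_iff[of K _ "\<lambda>n. ct n (p n) (r n)"] by blast
    thus ?thesis using M cartI[OF coh(1,3)] by simp
  next
    \<comment> \<open>In this case 1 + lw is mapped to 1 + l(t - w). Then K is semilinear and again
      determined by its first column.\<close>
    assume y: "null (\<lambda>n. int l + y n)"
    have "int l ^ n dvd 2 * (int l * t n - z n)" for n
    proof -
      have eqn: "2 * (int l * t n - z n) = (int l + y n) * t n + (int l * t n - 2 * z n - t n * y n)"
        by (simp add: algebra_simps)
      show ?thesis by (subst eqn) (intro R(3) nullD[OF y] dvd_add dvd_mult2)
    qed
    hence "null (\<lambda>n. 2 * (int l * t n - z n))" by (simp add: null_def)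
    hence z: "null (\<lambda>n. int l * t n - z n)"
      using cohz coh_t by (intro null_cmult[of "\<lambda>n. int l * t n - z n" 2]) auto
    have "int l ^ n dvd int l * (q n - t n * p n - d n * r n)" for n
    proof -
      have eqn: "int l * (q n - t n * p n - d n * r n) = (int l * q n - z n * p n + d n * y n * r n)
          - (int l * t n - z n) * p n - (int l + y n) * (d n * r n)" by (simp add: algebra_simps)
      show ?thesis by (subst eqn) (intro R(1) nullD[OF y] nullD[OF z] dvd_diff dvd_mult2)
    qed
    hence "null (\<lambda>n. int l * (q n - t n * p n - d n * r n))" by (simp add: null_def)
    hence q: "null (\<lambda>n. q n - t n * p n - d n * r n)"
      using coh coh_d coh_t l_nz by (intro null_cmult[of "\<lambda>n. q n - t n * p n - d n * r n" "int l"]) auto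
    have "int l ^ n dvd int l * (s n + p n)" for n
    proof -
      have eqn: "int l * (s n + p n) = (int l * s n - y n * p n - z n * r n - t n * y n * r n)
          + (int l + y n) * (p n + t n * r n) - (int l * t n - z n) * r n" by (simp add: algebra_simps)
      show ?thesis by (subst eqn) (intro R(2) nullD[OF y] nullD[OF z] dvd_add dvd_diff dvd_mult2)
    qed
    hence "null (\<lambda>n. int l * (s n + p n))" by (simp add: null_def)
    hence s: "null (\<lambda>n. s n + p n)"
      using coh l_nz by (intro null_cmult[of "\<lambda>n. s n + p n" "int l"]) auto
    have "redm (int l ^ n) (K n) = redm (int l ^ n) (tw n (p n) (r n))" for n
      unfolding K tw_def redm_eq_iff using nullD[OF q, of n] nullD[OF s, of n] by (simp add: algebra_simps)
    hence "M = cj (\<lambda>n. tw n (p n) (r n))"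
      unfolding KM using cj_eq_iff[of K _ "\<lambda>n. tw n (p n) (r n)"] by blast
    thus ?thesis using M twistI[OF coh(1,3)] by simp
  qed
qed

lemma normalizer_minus_cart: "normalizer l cart - cart = twist"
proof (intro equalityI subsetI)
  fix M assume M: "M \<in> twist"
  hence "M \<in> GL2 l" by (simp add: twist_def)
  then obtain M' where M': "M' \<in> GL2 l" "lmul l M M' = lid l" "lmul l M' M = lid l"
    using GL2_inverse by metis
  have "M \<in> normalizer l cart"
    unfolding normalizer_def using \<open>M \<in> GL2 l\<close> M' twist_conj_cart[OF M M'(1,2)] by blast
  thus "M \<in> normalizer l cart - cart" using M cart_twist_disjoint by blast
qed (use normalizer_cases in blast)

end

subsection \<open>Fixed points on the torsion module\<close>

context ladic begin

text \<open>The class of \<open>w / l ^ m\<close> in \<open>Q_l / Z_l\<close>.\<close>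
definition tor :: "nat \<Rightarrow> int \<Rightarrow> rat" where
  "tor m w = of_int (w mod int l ^ m) / of_int (int l ^ m)"

lemma tor_eq_iff: "tor m w = tor m w' \<longleftrightarrow> int l ^ m dvd w - w'"
  using l_nz by (simp add: tor_def mod_eq_dvd_iff)

lemma frac_divide: "frac (of_int w / of_int (int l ^ m)) = tor m w"
proof -
  have "\<lfloor>of_int w / of_int (int l ^ m) :: rat\<rfloor> = w div int l ^ m"
    by (rule floor_divide_of_int_eq)
  moreover have "(of_int w :: rat) = of_int (w div int l ^ m) * of_int (int l ^ m) + of_int (w mod int l ^ m)"
    by (metis div_mult_mod_eq of_int_add of_int_mult)
  ultimately show ?thesis
    using l_nz by (simp add: frac_def tor_def field_simps)
qed

lemma frac_lincomb_tor: "frac (of_int p * tor m w + of_int q * tor m w') = tor m (p * w + q * w')"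
proof -
  have "of_int p * tor m w + of_int q * tor m w' =
        of_int (p * (w mod int l ^ m) + q * (w' mod int l ^ m)) / of_int (int l ^ m)"
    by (simp add: tor_def add_divide_distrib)
  hence "frac (of_int p * tor m w + of_int q * tor m w') = tor m (p * (w mod int l ^ m) + q * (w' mod int l ^ m))"
    by (simp only: frac_divide)
  also have "\<dots> = tor m (p * w + q * w')"
    unfolding tor_eq_iff by (simp add: minus_mult_div_eq_mod [symmetric] algebra_simps)
  finally show ?thesis .
qed

lemma tor_add: "frac (tor m w + tor m w') = tor m (w + w')"
  using frac_lincomb_tor[of 1 m w 1 w'] by simp

lemma tor_bounds: "0 \<le> tor m w" "tor m w < 1"
  using l_gt_1 by (simp_all add: tor_def divide_less_eq del: of_int_power)

lemma tor_int: "tor m w * of_nat l ^ m \<in> \<int>"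
  using l_nz by (simp add: tor_def)

lemma tor_ex:
  assumes "0 \<le> x" "x < 1" "x * of_nat l ^ m \<in> \<int>"
  obtains w where "x = tor m w"
proof -
  obtain w where w: "x * of_nat l ^ m = of_int w" using assms(3) by (auto elim: Ints_cases)
  have "x = of_int w / of_int (int l ^ m)"
    using w l_nz by (simp add: field_simps)
  moreover have "frac x = x" using assms by (simp add: frac_eq)
  ultimately have "x = tor m w" by (metis frac_divide)
  thus ?thesis by (rule that)
qed

lemma tor_shift:
  assumes "k \<le> m" shows "tor k w = tor m (int l ^ (m - k) * w)"
proof -
  have "int l ^ m = int l ^ (m - k) * int l ^ k"
    using assms by (simp add: power_add[symmetric])
  thus ?thesis using l_nz by (simp add: tor_def mult_mod_right[symmetric])
qed

text \<open>\<open>act\<close> works at the least level that kills the point, which varies with the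
  point. Coherence of M allows any level m at which the point is written.\<close>

lemma act_tor:
  assumes "M \<in> Matl l" "M m = (p,q,r,s)"
  shows "act l M (tor m w, tor m z) = (tor m (p * w + q * z), tor m (r * w + s * z))"
proof -
  define \<Phi> where "\<Phi> = (\<lambda>k. tor m w * of_nat l ^ k \<in> \<int> \<and> tor m z * of_nat l ^ k \<in> \<int>)"
  define k where "k = (LEAST k. \<Phi> k)"
  have m: "\<Phi> m" by (simp add: \<Phi>_def tor_int)
  hence k: "\<Phi> k" "k \<le> m" unfolding k_def by (rule LeastI, rule Least_le)
  obtain u where u: "tor m w = tor k u"
    using k(1) tor_bounds tor_ex[of "tor m w" k] unfolding \<Phi>_def by blast
  obtain v where v: "tor m z = tor k v"
    using k(1) tor_bounds tor_ex[of "tor m z" k] unfolding \<Phi>_def by blast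
  obtain p' q' r' s' where Mk: "M k = (p',q',r',s')" by (cases "M k")
  have act: "act l M (tor m w, tor m z) = (tor k (p' * u + q' * v), tor k (r' * u + s' * v))"
    unfolding act_def Let_def fst_conv snd_conv \<Phi>_def[symmetric, THEN fun_cong] k_def[symmetric] Mk
    by (simp add: u v frac_lincomb_tor)
  have "redm (int l ^ k) (p,q,r,s) = redm (int l ^ k) (p',q',r',s')"
    using Matl_redm[OF assms(1) k(2)] Matl_redm_self[OF assms(1), of k] assms(2) Mk by metis
  hence d: "int l ^ k dvd p - p'" "int l ^ k dvd q - q'" "int l ^ k dvd r - r'" "int l ^ k dvd s - s'"
    unfolding redm_eq_iff by blast+
  \<comment> \<open>The factor by which numerators over \<open>l ^ k\<close> are multiplied when the
    same point is written over \<open>l ^ m\<close>.\<close>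
  define h where "h = int l ^ (m - k)"
  have lm: "int l ^ m = h * int l ^ k" unfolding h_def using k(2) by (simp add: power_add[symmetric])
  have uw: "int l ^ m dvd w - h * u" "int l ^ m dvd z - h * v"
    using u v tor_shift[OF k(2)] tor_eq_iff unfolding h_def by metis+
  have row: "tor k (p' * u + q' * v) = tor m (p * w + q * z)"
    if d: "int l ^ k dvd p - p'" "int l ^ k dvd q - q'" for p q p' q'
  proof -
    have "int l ^ m dvd h * (p - p')" "int l ^ m dvd h * (q - q')"
      unfolding lm using d by simp_all
    hence "int l ^ m dvd (w - h * u) * p + (z - h * v) * q + (h * (p - p')) * u + (h * (q - q')) * v"
      using uw by (meson dvd_add dvd_mult2)
    also have "\<dots> = (p * w + q * z) - h * (p' * u + q' * v)" by (simp add: algebra_simps)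
    finally have "tor m (p * w + q * z) = tor m (h * (p' * u + q' * v))" by (simp only: tor_eq_iff)
    thus ?thesis unfolding h_def tor_shift[OF k(2), of "p' * u + q' * v"] by simp
  qed
  show ?thesis unfolding act row[OF d(1,2)] row[OF d(3,4)] ..
qed

lemma carrier_QZ2: "carrier (QZ2 l) = {(r,s). 0 \<le> r \<and> r < 1 \<and> 0 \<le> s \<and> s < 1 \<and>
                 (\<exists>m. r * of_nat l ^ m \<in> \<int> \<and> s * of_nat l ^ m \<in> \<int>)}"
  by (simp add: QZ2_def)

lemma carrier_QZ2_tor: "(tor m w, tor m z) \<in> carrier (QZ2 l)"
  unfolding carrier_QZ2 using tor_bounds tor_int by blast

lemma carrier_QZ2E:
  assumes "v \<in> carrier (QZ2 l)"
  obtains m w z where "m \<ge> N" "v = (tor m w, tor m z)"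
proof -
  obtain x y m where v: "v = (x,y)" "0 \<le> x" "x < 1" "0 \<le> y" "y < 1"
    "x * of_nat l ^ m \<in> \<int>" "y * of_nat l ^ m \<in> \<int>"
    using assms unfolding carrier_QZ2 by blast
  obtain w where w: "x = tor m w" using tor_ex[OF v(2,3,6)] by blast
  obtain z where z: "y = tor m z" using tor_ex[OF v(4,5,7)] by blast
  have "v = (tor (max m N) (int l ^ (max m N - m) * w), tor (max m N) (int l ^ (max m N - m) * z))"
    unfolding v(1) w z by (subst (1 2) tor_shift[of m "max m N"]) simp_all
  thus ?thesis by (rule that[OF max.cobounded2])
qed

lemma tor_in_kerMI_iff:
  assumes "M \<in> Matl l" "M m = (p,q,r,s)"
  shows "(tor m w, tor m z) \<in> kerMI l M \<longleftrightarrow>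
         int l ^ m dvd (p - 1) * w + q * z \<and> int l ^ m dvd r * w + (s - 1) * z"
  using carrier_QZ2_tor[of m w z]
  by (simp add: kerMI_def act_tor[OF assms] tor_eq_iff algebra_simps)

text \<open>A Smith normal form argument. A row with a unit entry is completed to a basis in which
  the matrix becomes triangular with diagonal 1 and the determinant; multiplied by
  \<open>l ^ a\<close>, it has a kernel of the stated type. Divisibility of the determinant alone
  still gives a lower bound, which later excludes determinant zero.\<close>

lemma finite_abelian_kernel:
  fixes p q r s :: int and a b m :: nat
  defines "K \<equiv> {(tor m w, tor m z) | w z. int l ^ m dvd int l ^ a * (p * w + q * z) \<and>
                                           int l ^ m dvd int l ^ a * (r * w + s * z)}"
  assumes unit: "\<not> int l dvd p \<or> \<not> int l dvd q" and m: "a + b \<le> m"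
    and D: "int l ^ b dvd p * s - q * r"
  shows "finite K \<Longrightarrow> l ^ (2 * a + b) \<le> card K"
    and "\<not> int l ^ Suc b dvd p * s - q * r \<Longrightarrow>
      DirProd (integer_mod_group (l ^ a)) (integer_mod_group (l ^ (a + b))) \<cong> (QZ2 l)\<lparr>carrier := K\<rparr>"
proof -
  define h A B where "h = int l ^ (m - (a + b))" and "A = int l ^ a" and "B = int l ^ b"
  define L where "L = int l ^ m"
  have L: "L = A * B * h" "h \<noteq> 0" "A \<noteq> 0" "B \<noteq> 0" "A > 0" "B > 0"
    using m l_nz l_gt_1 unfolding L_def h_def A_def B_def by (simp_all add: power_add[symmetric])
  have "\<exists>\<alpha> \<beta>. L dvd p * \<alpha> + q * \<beta> - 1"
  proof (cases "int l dvd p")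
    case False
    then obtain x where "[p * x = 1] (mod L)"
      using cong_solve_coprime_int coprime_power_l unfolding L_def by blast
    hence "L dvd p * x + q * 0 - 1" by (simp add: cong_iff_dvd_diff)
    thus ?thesis by blast
  next
    case True
    then obtain x where "[q * x = 1] (mod L)"
      using unit cong_solve_coprime_int coprime_power_l unfolding L_def by blast
    hence "L dvd p * 0 + q * x - 1" by (simp add: cong_iff_dvd_diff)
    thus ?thesis by blast
  qed
  then obtain \<alpha> \<beta> k where \<alpha>\<beta>: "p * \<alpha> + q * \<beta> = 1 + L * k"
    by (auto simp: dvd_def algebra_simps)
  \<comment> \<open>Numerators over \<open>l ^ m\<close> of the combination of (\<alpha>, \<beta>) /
    \<open>l ^ a\<close> and (-q, p) / \<open>l ^ (a + b)\<close> with coefficients i and j. The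
    second vector is annihilated by the row (p, q).\<close>
  define f where "f i j = i * (B * h) * \<alpha> - j * h * q" for i j
  define g where "g i j = i * (B * h) * \<beta> + j * h * p" for i j
  define \<phi> where "\<phi> = (\<lambda>(i,j). (tor m (f i j), tor m (g i j)))"
  have \<phi>_in: "\<phi> (i,j) \<in> K" for i j
  proof -
    have "A * (p * f i j + q * g i j) = L * (i * (p * \<alpha> + q * \<beta>))"
      unfolding f_def g_def L by (simp add: algebra_simps)
    moreover obtain u where u: "p * s - q * r = B * u" using D unfolding B_def by blast
    have "A * (r * f i j + s * g i j) = L * (i * (r * \<alpha> + s * \<beta>)) + A * h * j * (p * s - q * r)"
      unfolding f_def g_def L by (simp add: algebra_simps)
    hence "A * (r * f i j + s * g i j) = L * (i * (r * \<alpha> + s * \<beta>) + j * u)"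
      unfolding u L by (simp add: algebra_simps)
    ultimately have "L dvd A * (p * f i j + q * g i j)" "L dvd A * (r * f i j + s * g i j)"
      by (metis dvd_triv_left)+
    thus ?thesis unfolding K_def \<phi>_def A_def L_def by auto
  qed
  have \<phi>_inj: "A dvd i - i' \<and> A * B dvd j - j'" if "\<phi> (i,j) = \<phi> (i',j')" for i j i' j'
  proof -
    define I J where "I = i - i'" and "J = j - j'"
    have F: "L dvd I * (B * h) * \<alpha> - J * h * q" and G: "L dvd I * (B * h) * \<beta> + J * h * p"
      using that unfolding \<phi>_def by (simp_all add: tor_eq_iff L_def f_def g_def I_def J_def algebra_simps)
    \<comment> \<open>Pairing with (p, q) removes J and, by the Bezout relation, isolates I.\<close>
    have "L dvd (I * (B * h) * \<alpha> - J * h * q) * p + (I * (B * h) * \<beta> + J * h * p) * q"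
      by (rule dvd_add[OF dvd_mult2[OF F] dvd_mult2[OF G]])
    also have "\<dots> = I * (B * h) * (1 + L * k)"
      unfolding \<alpha>\<beta>[symmetric] by (simp add: algebra_simps)
    also have "\<dots> = I * (B * h) + L * (k * I * (B * h))" by (simp add: algebra_simps)
    finally have "L dvd I * (B * h)" by (simp only: dvd_add_left_iff dvd_triv_left)
    hence "A * (B * h) dvd I * (B * h)" unfolding L(1) by (simp add: mult_ac)
    hence 1: "A dvd I" using L by simp
    \<comment> \<open>Pairing with (-\<beta>, \<alpha>) removes I and isolates J.\<close>
    have "L dvd (I * (B * h) * \<beta> + J * h * p) * \<alpha> - (I * (B * h) * \<alpha> - J * h * q) * \<beta>"
      by (rule dvd_diff[OF dvd_mult2[OF G] dvd_mult2[OF F]])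
    also have "\<dots> = J * h * (1 + L * k)"
      unfolding \<alpha>\<beta>[symmetric] by (simp add: algebra_simps)
    also have "\<dots> = J * h + L * (k * J * h)" by (simp add: algebra_simps)
    finally have "L dvd J * h" by (simp only: dvd_add_left_iff dvd_triv_left)
    hence "A * B dvd J" unfolding L(1) using L by simp
    with 1 show ?thesis by (simp add: I_def J_def)
  qed
  have \<phi>_mod: "\<phi> (i mod A, j mod (A * B)) = \<phi> (i, j)" for i j
  proof -
    have ij: "i mod A = i - A * (i div A)" "j mod (A * B) = j - A * B * (j div (A * B))"
      by (simp_all add: minus_mult_div_eq_mod)
    have "f (i mod A) (j mod (A * B)) - f i j = L * ((j div (A * B)) * q - (i div A) * \<alpha>)"
      unfolding f_def ij L by (simp add: algebra_simps)
    moreover have "g (i mod A) (j mod (A * B)) - g i j = L * (- (j div (A * B)) * p - (i div A) * \<beta>)"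
      unfolding g_def ij L by (simp add: algebra_simps)
    ultimately show ?thesis unfolding \<phi>_def by (simp add: tor_eq_iff L_def)
  qed
  have \<phi>_add: "\<phi> (i + i', j + j') = (case (\<phi> (i,j), \<phi> (i',j')) of ((x,y),(x',y')) \<Rightarrow> (frac (x + x'), frac (y + y')))"
    for i j i' j'
    by (simp add: \<phi>_def tor_add f_def g_def algebra_simps)
  have AB: "int (l ^ a) = A" "int (l ^ (a + b)) = A * B"
    by (simp_all add: A_def B_def power_add)
  define S where "S = {0..<A} \<times> {0..<A * B}"
  have inj: "inj_on \<phi> S"
  proof (rule inj_onI)
    fix x y assume "x \<in> S" "y \<in> S" "\<phi> x = \<phi> y"
    moreover obtain i j i' j' where "x = (i,j)" "y = (i',j')" by (cases x; cases y)
    ultimately have "i mod A = i' mod A" "j mod (A * B) = j' mod (A * B)" "x = (i,j)" "y = (i',j')"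
      "0 \<le> i" "i < A" "0 \<le> i'" "i' < A" "0 \<le> j" "j < A * B" "0 \<le> j'" "j' < A * B"
      using \<phi>_inj unfolding mod_eq_dvd_iff S_def by auto
    thus "x = y" by simp
  qed
  have "card S = l ^ (2 * a + b)"
  proof -
    have "card S = nat A * nat (A * B)" unfolding S_def by (simp add: card_cartesian_product)
    also have "\<dots> = l ^ a * l ^ (a + b)" by (metis AB nat_int)
    finally show ?thesis by (simp add: power_add[symmetric] mult_2 add.assoc)
  qed
  thus "l ^ (2 * a + b) \<le> card K" if "finite K"
    using card_inj_on_le[OF inj _ that] \<phi>_in by (auto simp: S_def)
  assume nD: "\<not> int l ^ Suc b dvd p * s - q * r"
  have surj: "K \<subseteq> \<phi> ` S"
  proof
    fix v assume "v \<in> K"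
    then obtain w z where v: "v = (tor m w, tor m z)"
      and wz: "L dvd A * (p * w + q * z)" "L dvd A * (r * w + s * z)"
      unfolding K_def L_def A_def by blast
    have "A * (B * h) dvd A * (p * w + q * z)" using wz(1) unfolding L(1) by (simp add: mult_ac)
    then obtain i where i: "p * w + q * z = B * h * i" using L by auto
    \<comment> \<open>The coordinate of (w, z) along (-q, p). It remains to show that J is a
      multiple of h.\<close>
    define J where "J = \<alpha> * z - \<beta> * w"
    have iw: "i * (B * h) * e = e * (p * w + q * z)" for e
      unfolding i by (simp add: mult_ac)
    have "i * (B * h) * \<alpha> - J * q - w = (p * \<alpha> + q * \<beta>) * w - w"
      unfolding iw J_def by (simp add: algebra_simps)
    hence wJ: "i * (B * h) * \<alpha> - J * q - w = L * (k * w)"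
      unfolding \<alpha>\<beta> by (simp add: algebra_simps)
    have "i * (B * h) * \<beta> + J * p - z = (p * \<alpha> + q * \<beta>) * z - z"
      unfolding iw J_def by (simp add: algebra_simps)
    hence zJ: "i * (B * h) * \<beta> + J * p - z = L * (k * z)"
      unfolding \<alpha>\<beta> by (simp add: algebra_simps)
    \<comment> \<open>The second row takes (-q, p) to the determinant, so the second kernel
      condition becomes a condition on J.\<close>
    have "A * (J * (p * s - q * r)) = A * (r * w + s * z) - L * (i * (r * \<alpha> + s * \<beta>))
            + (A * r * (i * (B * h) * \<alpha> - J * q - w) + A * s * (i * (B * h) * \<beta> + J * p - z))"
      unfolding L(1) by (simp add: algebra_simps)
    also have "\<dots> = A * (r * w + s * z) - L * (i * (r * \<alpha> + s * \<beta>)) + L * (A * (k * (r * w + s * z)))"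
      unfolding wJ zJ by (simp add: algebra_simps)
    finally have "A * (J * (p * s - q * r)) = A * (r * w + s * z) - L * (i * (r * \<alpha> + s * \<beta>))
            + L * (A * (k * (r * w + s * z)))" .
    hence "L dvd A * (J * (p * s - q * r))"
      using wz(2) by (metis dvd_add dvd_diff dvd_triv_left)
    hence "B * h dvd J * (p * s - q * r)" using L by (simp add: mult_ac)
    moreover obtain u where u: "p * s - q * r = B * u" using D unfolding B_def by blast
    ultimately have "h dvd J * u" using L by (simp add: mult_ac)
    \<comment> \<open>Exactness of the valuation enters here and bounds the kernel from
      above.\<close>
    moreover have "\<not> int l dvd u" using nD u unfolding B_def by auto
    hence "coprime u h" unfolding h_def by (rule coprime_power_l)
    ultimately have "h dvd J" by (simp add: coprime_dvd_mult_left_iff coprime_commute)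
    then obtain j where j: "J = h * j" by blast
    have "f i j - w = L * (k * w)" "g i j - z = L * (k * z)"
      using wJ zJ unfolding f_def g_def j by (simp_all add: mult_ac)
    hence "tor m (f i j) = tor m w" "tor m (g i j) = tor m z"
      unfolding tor_eq_iff L_def[symmetric] by simp_all
    hence "v = \<phi> (i, j)" unfolding v \<phi>_def by simp
    also have "\<dots> = \<phi> (i mod A, j mod (A * B))" by (rule \<phi>_mod[symmetric])
    finally have "v = \<phi> (i mod A, j mod (A * B))" .
    moreover have "(i mod A, j mod (A * B)) \<in> S" using L by (simp add: S_def)
    ultimately show "v \<in> \<phi> ` S" by blast
  qed
  have carr: "carrier (DirProd (integer_mod_group (l ^ a)) (integer_mod_group (l ^ (a + b)))) = S"
    using l_gt_1 by (simp add: S_def carrier_integer_mod_group AB del: of_nat_power)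
  have "\<phi> \<in> iso (DirProd (integer_mod_group (l ^ a)) (integer_mod_group (l ^ (a + b)))) ((QZ2 l)\<lparr>carrier := K\<rparr>)"
    unfolding iso_def
  proof (intro CollectI conjI homI)
    fix x assume "x \<in> carrier (DirProd (integer_mod_group (l ^ a)) (integer_mod_group (l ^ (a + b))))"
    thus "\<phi> x \<in> carrier ((QZ2 l)\<lparr>carrier := K\<rparr>)" using \<phi>_in by (cases x) simp
  next
    fix x y :: "int \<times> int"
    obtain i j i' j' where xy: "x = (i,j)" "y = (i',j')" by (cases x; cases y)
    show "\<phi> (x \<otimes>\<^bsub>DirProd (integer_mod_group (l ^ a)) (integer_mod_group (l ^ (a + b)))\<^esub> y) =
          \<phi> x \<otimes>\<^bsub>(QZ2 l)\<lparr>carrier := K\<rparr>\<^esub> \<phi> y"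
      unfolding xy DirProd_def by (simp add: AB \<phi>_mod \<phi>_add QZ2_def case_prod_beta del: of_nat_power)
  next
    show "bij_betw \<phi> (carrier (DirProd (integer_mod_group (l ^ a)) (integer_mod_group (l ^ (a + b)))))
       (carrier ((QZ2 l)\<lparr>carrier := K\<rparr>))"
      unfolding carr using inj surj \<phi>_in by (auto simp: bij_betw_def)
  qed
  thus "DirProd (integer_mod_group (l ^ a)) (integer_mod_group (l ^ (a + b))) \<cong> (QZ2 l)\<lparr>carrier := K\<rparr>"
    by (rule is_isoI)
qed

lemma DirProd_pow:
  "x [^]\<^bsub>DirProd G H\<^esub> (n::nat) = (fst x [^]\<^bsub>G\<^esub> n, snd x [^]\<^bsub>H\<^esub> n)"
  by (induction n) (simp_all add: nat_pow_def DirProd_def case_prod_beta)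

text \<open>The second factor of the source has an element of order \<open>l ^ (a + b)\<close>,
  while \<open>l ^ (a' + b')\<close> annihilates the target.\<close>

lemma exponent_le:
  assumes "DirProd (integer_mod_group (l ^ a)) (integer_mod_group (l ^ (a + b))) \<cong>
           DirProd (integer_mod_group (l ^ a')) (integer_mod_group (l ^ (a' + b')))" (is "?G \<cong> ?H")
  shows "a + b \<le> a' + b'"
proof -
  obtain f where f: "f \<in> iso ?G ?H" using assms by (auto simp: is_iso_def)
  have grp: "group ?G" "group ?H" by (simp_all add: DirProd_group)
  \<comment> \<open>The reduction of 1 matters when a + b = 0: the second factor is then trivial
    with carrier {0}.\<close>
  define x where "x = (0 :: int, 1 mod int (l ^ (a + b)))"
  have x: "x \<in> carrier ?G"
    using l_gt_1 by (simp add: x_def carrier_integer_mod_group)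
  define N where "N = l ^ (a' + b')"
  have "int (l ^ a') dvd int N" by (simp add: N_def power_add)
  hence "int N * e mod int (l ^ a') = 0" "int N * e mod int N = 0" for e
    by (simp_all add: mod_eq_0_iff_dvd)
  hence "f x [^]\<^bsub>?H\<^esub> N = \<one>\<^bsub>?H\<^esub>"
    unfolding DirProd_pow pow_integer_mod_group one_DirProd one_integer_mod_group N_def[symmetric] by simp
  moreover have "f (x [^]\<^bsub>?G\<^esub> N) = f x [^]\<^bsub>?H\<^esub> N"
    using f unfolding iso_def by (intro hom_nat_pow[OF _ x grp]) blast
  moreover have "f \<one>\<^bsub>?G\<^esub> = \<one>\<^bsub>?H\<^esub>"
    using f unfolding iso_def by (intro hom_one[OF _ grp]) blast
  ultimately have eq: "f (x [^]\<^bsub>?G\<^esub> N) = f \<one>\<^bsub>?G\<^esub>" by simp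
  have inj: "inj_on f (carrier ?G)" using f unfolding iso_def bij_betw_def by blast
  have "x [^]\<^bsub>?G\<^esub> N = \<one>\<^bsub>?G\<^esub>"
    using monoid.nat_pow_closed[OF group.is_monoid[OF grp(1)] x] monoid.one_closed[OF group.is_monoid[OF grp(1)]]
    by (rule inj_onD[OF inj eq])
  hence "int N * (1 mod int (l ^ (a + b))) mod int (l ^ (a + b)) = 0"
    unfolding DirProd_pow pow_integer_mod_group one_DirProd one_integer_mod_group x_def snd_conv by blast
  hence "int N mod int (l ^ (a + b)) = 0"
    by (simp only: mod_mult_right_eq mult_1_right)
  hence "int (l ^ (a + b)) dvd int N" by (simp only: dvd_eq_mod_eq_0)
  hence "l ^ (a + b) dvd l ^ (a' + b')" unfolding N_def by (simp only: int_dvd_int_iff)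
  thus ?thesis using l_gt_1 by (simp add: dvd_power_iff_le)
qed

text \<open>The exponent determines a + b and the order determines 2a + b.\<close>

lemma integer_mod_products_iso_unique:
  assumes "DirProd (integer_mod_group (l ^ a)) (integer_mod_group (l ^ (a + b))) \<cong>
           DirProd (integer_mod_group (l ^ a')) (integer_mod_group (l ^ (a' + b')))" (is "?G \<cong> ?H")
  shows "a = a' \<and> b = b'"
proof -
  have "?H \<cong> ?G" by (rule group.iso_sym[OF _ assms]) (simp add: DirProd_group)
  hence exp: "a + b = a' + b'" by (rule antisym[OF exponent_le[OF assms] exponent_le])
  have card: "card (carrier (DirProd (integer_mod_group (l ^ a)) (integer_mod_group (l ^ (a + b))))) = l ^ (2 * a + b)" for a b
  proof -
    have "card (carrier (integer_mod_group (l ^ n))) = l ^ n" for n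
      using l_gt_1 unfolding carrier_integer_mod_group by (simp flip: of_nat_power)
    thus ?thesis by (simp add: card_cartesian_product power_add[symmetric] mult_2 add.assoc)
  qed
  have "l ^ (2 * a + b) = l ^ (2 * a' + b')"
    using iso_same_card[OF assms] unfolding card .
  hence "2 * a + b = 2 * a' + b'" using l_gt_1 by simp
  with exp show ?thesis by simp
qed

section \<open>The digits of M - I and the isomorphism type of its kernel\<close>

definition id_mod :: "(nat \<Rightarrow> mat2) \<Rightarrow> nat \<Rightarrow> bool" where
  "id_mod M j \<longleftrightarrow> M j = lid l j"

definition det_dvd :: "(nat \<Rightarrow> mat2) \<Rightarrow> nat \<Rightarrow> bool" where
  "det_dvd M j \<longleftrightarrow> int l ^ j dvd det2 (sub2 (M j) id2)"

lemma id_mod_level: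
  assumes "M \<in> Matl l" "j \<le> k"
  shows "id_mod M j \<longleftrightarrow> redm (int l ^ j) (M k) = redm (int l ^ j) id2"
  using Matl_redm[OF assms] by (simp add: id_mod_def lid_def)

lemma det_dvd_level:
  assumes "M \<in> Matl l" "j \<le> k"
  shows "det_dvd M j \<longleftrightarrow> int l ^ j dvd det2 (sub2 (M k) id2)"
proof -
  have "redm (int l ^ j) (M j) = redm (int l ^ j) (M k)"
    using Matl_redm[OF assms] Matl_redm_self[OF assms(1)] by simp
  hence "det2 (sub2 (M j) id2) mod int l ^ j = det2 (sub2 (M k) id2) mod int l ^ j"
    by (intro det2_redm redm_sub2_cong)
  thus ?thesis by (simp add: det_dvd_def dvd_eq_mod_eq_0)
qed

lemma det_dvd_antimono:
  assumes "M \<in> Matl l" "det_dvd M k" "j \<le> k"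
  shows "det_dvd M j"
  using assms det_dvd_level[OF assms(1,3)] unfolding det_dvd_def by (meson dvd_trans le_imp_power_dvd)

lemma minus_id_factor:
  assumes "M \<in> Matl l" "id_mod M a" "\<not> id_mod M (Suc a)" "m > a"
  obtains p q r s where "M m = (1 + int l ^ a * p, int l ^ a * q, int l ^ a * r, 1 + int l ^ a * s)"
    "\<not> int l dvd p \<or> \<not> int l dvd q \<or> \<not> int l dvd r \<or> \<not> int l dvd s"
proof -
  obtain p' q' r' s' where Mm: "M m = (p',q',r',s')" by (cases "M m")
  have "redm (int l ^ a) (M m) = redm (int l ^ a) id2"
    using id_mod_level[OF assms(1), of a m] assms by simp
  hence "int l ^ a dvd p' - 1" "int l ^ a dvd q' - 0" "int l ^ a dvd r' - 0" "int l ^ a dvd s' - 1"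
    unfolding Mm id2_def redm_eq_iff by blast+
  then obtain p q r s where e: "p' - 1 = int l ^ a * p" "q' - 0 = int l ^ a * q"
    "r' - 0 = int l ^ a * r" "s' - 1 = int l ^ a * s" unfolding dvd_def by blast
  have "\<not> redm (int l ^ Suc a) (M m) = redm (int l ^ Suc a) id2"
    using id_mod_level[OF assms(1), of "Suc a" m] assms by simp
  hence "\<not> (int l ^ a * int l dvd int l ^ a * p \<and> int l ^ a * int l dvd int l ^ a * q \<and>
             int l ^ a * int l dvd int l ^ a * r \<and> int l ^ a * int l dvd int l ^ a * s)"
    unfolding Mm id2_def redm_eq_iff e power_Suc2 by blast
  hence "\<not> int l dvd p \<or> \<not> int l dvd q \<or> \<not> int l dvd r \<or> \<not> int l dvd s"
    using l_nz by auto
  moreover have "M m = (1 + int l ^ a * p, int l ^ a * q, int l ^ a * r, 1 + int l ^ a * s)"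
    unfolding Mm using e by (simp add: algebra_simps)
  ultimately show ?thesis using that by blast
qed

lemma det2_minus_id:
  "det2 (sub2 (1 + int l ^ a * p, int l ^ a * q, int l ^ a * r, 1 + int l ^ a * s) id2) =
   int l ^ (2 * a) * (p * s - q * r)"
  unfolding id2_def power_even_eq by (simp add: algebra_simps power2_eq_square)

text \<open>The \<open>l ^ m\<close>-torsion K of the kernel is computed by
  \<open>finite_abelian_kernel\<close>. As a subset it already gives the lower bound; for the
  isomorphism, all of the kernel must be shown to lie in it.\<close>

lemma kerMI_structure:
  assumes M: "M \<in> Matl l" "id_mod M a" "\<not> id_mod M (Suc a)" "det_dvd M (2 * a + b)"
  shows "finite (kerMI l M) \<Longrightarrow> l ^ (2 * a + b) \<le> card (kerMI l M)"
    and "\<not> det_dvd M (Suc (2 * a + b)) \<Longrightarrow>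
      DirProd (integer_mod_group (l ^ a)) (integer_mod_group (l ^ (a + b))) \<cong> (QZ2 l)\<lparr>carrier := kerMI l M\<rparr>"
proof -
  \<comment> \<open>The first level at which it is visible whether the determinant has valuation
    exactly 2a + b.\<close>
  define m where "m = Suc (2 * a + b)"
  have id_mod: "a < m" by (simp add: m_def)
  obtain p q r s where Mm: "M m = (1 + int l ^ a * p, int l ^ a * q, int l ^ a * r, 1 + int l ^ a * s)"
    and unit: "\<not> int l dvd p \<or> \<not> int l dvd q \<or> \<not> int l dvd r \<or> \<not> int l dvd s"
    by (rule minus_id_factor[OF M(1-3) id_mod])
  define K where "K = {(tor m w, tor m z) | w z. int l ^ m dvd int l ^ a * (p * w + q * z) \<and>
                                           int l ^ m dvd int l ^ a * (r * w + s * z)}"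
  have K_iff: "(tor m w, tor m z) \<in> kerMI l M \<longleftrightarrow> int l ^ m dvd int l ^ a * (p * w + q * z) \<and>
                                           int l ^ m dvd int l ^ a * (r * w + s * z)" for w z
    unfolding tor_in_kerMI_iff[OF M(1) Mm] by (simp add: algebra_simps)
  have K_sub: "K \<subseteq> kerMI l M" unfolding K_def using K_iff by blast
  have det: "det2 (sub2 (M m) id2) = int l ^ (2 * a) * (p * s - q * r)"
    unfolding Mm by (rule det2_minus_id)
  have det_dvd_iff: "det_dvd M (2 * a + j) \<longleftrightarrow> int l ^ j dvd p * s - q * r" if "2 * a + j \<le> m" for j
    unfolding det_dvd_level[OF M(1) that] det power_add using l_nz by simp
  have D: "int l ^ b dvd p * s - q * r" using det_dvd_iff[of b] M(4) by (simp add: m_def)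
  \<comment> \<open>If the unit entry is in the second row, the rows are exchanged; this keeps K and
    changes the sign of the determinant.\<close>
  have D': "int l ^ b dvd r * q - s * p"
  proof -
    have "r * q - s * p = - (p * s - q * r)" by (simp add: algebra_simps)
    thus ?thesis using D by (simp only: dvd_minus_iff)
  qed
  have abm: "a + b \<le> m" by (simp add: m_def)
  have K': "K = {(tor m w, tor m z) | w z. int l ^ m dvd int l ^ a * (r * w + s * z) \<and>
                                           int l ^ m dvd int l ^ a * (p * w + q * z)}"
    unfolding K_def by (simp only: conj_commute)
  have "finite K \<Longrightarrow> l ^ (2 * a + b) \<le> card K"
  proof (cases "\<not> int l dvd p \<or> \<not> int l dvd q")
    case True
    assume "finite K" thus ?thesis
      using finite_abelian_kernel(1)[OF True abm D] unfolding K_def by blast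
  next
    case False
    hence rs: "\<not> int l dvd r \<or> \<not> int l dvd s" using unit by blast
    assume "finite K" thus ?thesis
      using finite_abelian_kernel(1)[OF rs abm D'] unfolding K' by blast
  qed
  thus "l ^ (2 * a + b) \<le> card (kerMI l M)" if "finite (kerMI l M)"
    using that K_sub by (meson card_mono finite_subset le_trans)
  assume nd: "\<not> det_dvd M (Suc (2 * a + b))"
  hence nD: "\<not> int l ^ Suc b dvd p * s - q * r"
    using det_dvd_iff[of "Suc b"] by (simp add: m_def)
  have nD': "\<not> int l ^ Suc b dvd r * q - s * p"
  proof -
    have "r * q - s * p = - (p * s - q * r)" by (simp add: algebra_simps)
    thus ?thesis using nD by (simp only: dvd_minus_iff not_False_eq_True)
  qed
  \<comment> \<open>By Cramer's rule det (M - I) kills every fixed point. Its valuation 2a + b is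
    less than m, so every fixed point is \<open>l ^ m\<close>-torsion.\<close>
  have "kerMI l M \<subseteq> K"
  proof
    fix v assume v: "v \<in> kerMI l M"
    then obtain k w z where k: "k \<ge> m" and vk: "v = (tor k w, tor k z)"
      using carrier_QZ2E[of v m] unfolding kerMI_def by blast
    obtain P Q R S where Mk: "M k = (P,Q,R,S)" by (cases "M k")
    have wz: "int l ^ k dvd (P - 1) * w + Q * z" "int l ^ k dvd R * w + (S - 1) * z"
      using v unfolding vk tor_in_kerMI_iff[OF M(1) Mk] by blast+
    have detk: "det2 (sub2 (M k) id2) = (P - 1) * (S - 1) - Q * R" by (simp add: Mk id2_def)
    have "int l ^ (2 * a + b) dvd (P - 1) * (S - 1) - Q * R"
      using det_dvd_level[OF M(1), of "2 * a + b" k] M(4) k detk by (simp add: m_def)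
    then obtain u where u: "(P - 1) * (S - 1) - Q * R = int l ^ (2 * a + b) * u" by blast
    have "\<not> int l ^ Suc (2 * a + b) dvd (P - 1) * (S - 1) - Q * R"
      using det_dvd_level[OF M(1), of "Suc (2 * a + b)" k] nd k detk by (simp add: m_def)
    hence "\<not> int l dvd u" unfolding u power_Suc2 using l_nz by simp
    hence cop: "coprime u (int l ^ n)" for n by (rule coprime_power_l)
    have div: "int l ^ (k - m) dvd x" if "int l ^ k dvd int l ^ (2 * a + b) * u * x" for x
    proof -
      have "int l ^ k = int l ^ (2 * a + b) * int l ^ (k - (2 * a + b))"
        using k by (simp add: m_def power_add[symmetric])
      hence "int l ^ (k - (2 * a + b)) dvd u * x"
        using that l_nz by (simp add: mult.assoc)
      hence "int l ^ (k - (2 * a + b)) dvd x"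
        using cop[of "k - (2 * a + b)"] coprime_dvd_mult_right_iff[of "int l ^ (k - (2 * a + b))" u x]
          coprime_commute by blast
      thus ?thesis by (rule dvd_trans[rotated]) (simp add: m_def le_imp_power_dvd)
    qed
    have "int l ^ (2 * a + b) * u * w = ((P - 1) * w + Q * z) * (S - 1) - (R * w + (S - 1) * z) * Q"
      unfolding u[symmetric] by (simp add: algebra_simps)
    also have "int l ^ k dvd \<dots>" by (rule dvd_diff[OF dvd_mult2[OF wz(1)] dvd_mult2[OF wz(2)]])
    finally obtain w' where w': "w = int l ^ (k - m) * w'" using div by blast
    have "int l ^ (2 * a + b) * u * z = (R * w + (S - 1) * z) * (P - 1) - ((P - 1) * w + Q * z) * R"
      unfolding u[symmetric] by (simp add: algebra_simps)
    also have "int l ^ k dvd \<dots>" by (rule dvd_diff[OF dvd_mult2[OF wz(2)] dvd_mult2[OF wz(1)]])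
    finally obtain z' where z': "z = int l ^ (k - m) * z'" using div by blast
    have "v = (tor m w', tor m z')"
      unfolding vk w' z' tor_shift[OF k] ..
    thus "v \<in> K" using v K_iff unfolding K_def by blast
  qed
  hence Keq: "K = kerMI l M" using K_sub by blast
  show "DirProd (integer_mod_group (l ^ a)) (integer_mod_group (l ^ (a + b))) \<cong> (QZ2 l)\<lparr>carrier := kerMI l M\<rparr>"
  proof (cases "\<not> int l dvd p \<or> \<not> int l dvd q")
    case True
    show ?thesis
      using finite_abelian_kernel(2)[OF True abm D nD] unfolding Keq[symmetric] K_def .
  next
    case False
    hence rs: "\<not> int l dvd r \<or> \<not> int l dvd s" using unit by blast
    show ?thesis
      using finite_abelian_kernel(2)[OF rs abm D' nD'] unfolding Keq[symmetric] K' .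
  qed
qed

text \<open>For the direction from the kernel to the digits, M has some invariants a' and b' of its
  own; its kernel then has the type given by them, and uniqueness of the type identifies them with a
  and b.\<close>

lemma kerMI_iso_iff:
  assumes M: "M \<in> Matl l" and "\<not> id_mod M j"
  shows "(QZ2 l)\<lparr>carrier := kerMI l M\<rparr> \<cong>
           DirProd (integer_mod_group (l ^ a)) (integer_mod_group (l ^ (a + b))) \<longleftrightarrow>
         id_mod M a \<and> \<not> id_mod M (Suc a) \<and> det_dvd M (2 * a + b) \<and> \<not> det_dvd M (Suc (2 * a + b))"
    (is "?K \<cong> ?G a b \<longleftrightarrow> ?R a b")
proof
  have grp: "group (?G a b)" for a b by (simp add: DirProd_group)
  have iso: "?G a b \<cong> ?K" if "?R a b" for a b
    using that kerMI_structure(2)[OF M] by blast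
  show "?R a b \<Longrightarrow> ?K \<cong> ?G a b"
    using iso group.iso_sym[OF grp] by blast
  assume K: "?K \<cong> ?G a b"
  have "\<exists>i. id_mod M i \<and> \<not> id_mod M (Suc i)"
  proof (rule ccontr)
    assume *: "\<nexists>i. id_mod M i \<and> \<not> id_mod M (Suc i)"
    have "id_mod M i" for i
    proof (induction i)
      case 0
      show ?case using Matl_redm_self[OF M, of 0] by (cases "M 0") (simp add: id_mod_def lid_def id2_def)
    qed (use * in blast)
    with assms(2) show False by blast
  qed
  then obtain a' where a': "id_mod M a'" "\<not> id_mod M (Suc a')" by blast
  have "\<exists>k. \<not> det_dvd M k"
  proof (rule ccontr)
    assume *: "\<nexists>k. \<not> det_dvd M k"
    \<comment> \<open>With determinant zero the lower bound \<open>l ^ (2 * a' + j)\<close> would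
      hold for every j; j equal to the order of the kernel is contradictory.\<close>
    have card: "card (kerMI l M) = card (carrier (?G a b))" using iso_same_card[OF K] by simp
    have "card (carrier (?G a b)) > 0"
      using l_gt_1 by (simp add: carrier_integer_mod_group card_cartesian_product)
    hence "finite (kerMI l M)" using card card_ge_0_finite by metis
    hence "l ^ (2 * a' + card (kerMI l M)) \<le> card (kerMI l M)"
      using kerMI_structure(1)[OF M a'] * by blast
    moreover have "card (kerMI l M) < l ^ card (kerMI l M)"
      using l_gt_1 power_gt_expt[of l "card (kerMI l M)"] by simp
    moreover have "l ^ card (kerMI l M) \<le> l ^ (2 * a' + card (kerMI l M))"
      using l_gt_1 by (intro power_increasing) auto
    ultimately show False by linarith
  qed
  \<comment> \<open>M - I is \<open>l ^ a'\<close> times a matrix, so its determinant has valuation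
    at least 2a'. This makes the subtraction defining b' exact.\<close>
  moreover have "det_dvd M (2 * a')"
  proof -
    obtain p q r s where "M (Suc (2 * a')) = (1 + int l ^ a' * p, int l ^ a' * q, int l ^ a' * r, 1 + int l ^ a' * s)"
      by (rule minus_id_factor[OF M a', of "Suc (2 * a')"]) auto
    hence "det2 (sub2 (M (Suc (2 * a'))) id2) = int l ^ (2 * a') * (p * s - q * r)"
      by (simp only: det2_minus_id)
    thus ?thesis using det_dvd_level[OF M, of "2 * a'" "Suc (2 * a')"] by simp
  qed
  ultimately have "\<exists>k\<ge>2 * a'. det_dvd M k \<and> \<not> det_dvd M (Suc k)"
    using det_dvd_antimono[OF M] dec_induct[of "2 * a'" _ "det_dvd M"] nat_le_linear[of "2 * a'"] by blast
  then obtain k where k: "k \<ge> 2 * a'" "det_dvd M k" "\<not> det_dvd M (Suc k)" by blast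
  define b' where "b' = k - 2 * a'"
  have R': "?R a' b'" using a' k by (simp add: b'_def)
  have "?G a' b' \<cong> ?G a b" by (rule iso_trans[OF iso[OF R'] K])
  hence "a' = a \<and> b' = b" by (rule integer_mod_products_iso_unique)
  thus "?R a b" using R' by blast
qed

subsection \<open>The level\<close>

lemma normalizer_GL2: "g \<in> normalizer l C \<Longrightarrow> g \<in> GL2 l"
  by (simp add: normalizer_def)

lemma normalizer_mult:
  assumes "g \<in> normalizer l C" "h \<in> normalizer l C"
  shows "lmul l g h \<in> normalizer l C"
proof -
  obtain g' where g: "g \<in> GL2 l" "g' \<in> GL2 l" "lmul l g g' = lid l" "lmul l g' g = lid l"
    "(\<lambda>x. lmul l g (lmul l x g')) ` C = C" using assms(1) unfolding normalizer_def by blast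
  obtain h' where h: "h \<in> GL2 l" "h' \<in> GL2 l" "lmul l h h' = lid l" "lmul l h' h = lid l"
    "(\<lambda>x. lmul l h (lmul l x h')) ` C = C" using assms(2) unfolding normalizer_def by blast
  have eq: "lmul l (lmul l g h) (lmul l x (lmul l h' g')) = lmul l g (lmul l (lmul l h (lmul l x h')) g')" for x
    by (simp add: lmul_assoc)
  have "(\<lambda>x. lmul l (lmul l g h) (lmul l x (lmul l h' g'))) ` C =
        (\<lambda>x. lmul l g (lmul l x g')) ` ((\<lambda>x. lmul l h (lmul l x h')) ` C)"
    unfolding eq image_image ..
  also have "\<dots> = C" unfolding h(5) by (rule g(5))
  finally have "(\<lambda>x. lmul l (lmul l g h) (lmul l x (lmul l h' g'))) ` C = C" .
  moreover have "lmul l (lmul l g h) (lmul l h' g') = lid l"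
    using lmul_lid(1)[OF GL2_Matl[OF g(2)]] by (metis lmul_assoc h(3) g(3))
  moreover have "lmul l (lmul l h' g') (lmul l g h) = lid l"
    using lmul_lid(1)[OF GL2_Matl[OF h(1)]] by (metis lmul_assoc h(4) g(4))
  ultimately show ?thesis
    unfolding normalizer_def using lmul_in_GL2[OF g(1) h(1)] lmul_in_GL2[OF h(2) g(2)] by blast
qed

lemma normalizer_inverse:
  assumes "C \<subseteq> Matl l" "g \<in> normalizer l C"
  obtains g' where "g' \<in> normalizer l C" "lmul l g g' = lid l" "lmul l g' g = lid l"
proof -
  obtain g' where g: "g \<in> GL2 l" "g' \<in> GL2 l" "lmul l g g' = lid l" "lmul l g' g = lid l"
    "(\<lambda>x. lmul l g (lmul l x g')) ` C = C" using assms(2) unfolding normalizer_def by blast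
  have eq: "lmul l g' (lmul l (lmul l g (lmul l x g')) g) = x" if "x \<in> C" for x
  proof -
    have "lmul l g' (lmul l (lmul l g (lmul l x g')) g) = lmul l (lmul l g' g) (lmul l x (lmul l g' g))"
      by (simp only: lmul_assoc)
    thus ?thesis using that assms(1) by (auto simp: g(4) lmul_lid)
  qed
  have "(\<lambda>x. lmul l g' (lmul l x g)) ` C = (\<lambda>x. lmul l g' (lmul l x g)) ` ((\<lambda>x. lmul l g (lmul l x g')) ` C)"
    by (simp only: g(5))
  also have "\<dots> = C" unfolding image_image using eq by simp
  finally have "g' \<in> normalizer l C"
    unfolding normalizer_def using g(1-4) by blast
  with g show ?thesis using that by blast
qed

lemma finite_img:
  assumes "S \<subseteq> Matl l" shows "finite (img S n)"
proof -
  have "img S n \<subseteq> {0..<int l ^ n} \<times> {0..<int l ^ n} \<times> {0..<int l ^ n} \<times> {0..<int l ^ n}"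
  proof
    fix A assume "A \<in> img S n"
    hence "redm (int l ^ n) A = A" using assms Matl_redm_self by (auto simp: img_def)
    moreover have "x mod int l ^ n \<in> {0..<int l ^ n}" for x using l_gt_1 by simp
    ultimately show "A \<in> {0..<int l ^ n} \<times> {0..<int l ^ n} \<times> {0..<int l ^ n} \<times> {0..<int l ^ n}"
      by (cases A) (metis Pair_inject SigmaI redm.simps)
  qed
  thus ?thesis by (rule finite_subset) simp
qed

lemma level_ge: "level l N G \<ge> (if l = 2 then 2 else 0)"
  by (simp add: level_def Let_def)

text \<open>The fibres of the reduction of cosets \<open>N/G \<rightarrow> N(n)/G(n)\<close> are singletons as soon as both
  sides have the same finite cardinality.\<close>
lemma level_kernel:
  assumes C: "C \<subseteq> Matl l" and N: "N = normalizer l C" and G: "open_subgroup_of l G N"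
    and n: "n \<ge> level l N G" and h: "h \<in> N" "h n = lid l n"
  shows "h \<in> G"
proof -
  have GN: "G \<subseteq> N" and lidG: "lid l \<in> G" and Gm: "\<And>g h. g \<in> G \<Longrightarrow> h \<in> G \<Longrightarrow> lmul l g h \<in> G"
    and Gi: "\<And>g. g \<in> G \<Longrightarrow> \<exists>h\<in>G. lmul l g h = lid l"
    using G unfolding open_subgroup_of_def by auto
  obtain k where k: "{h \<in> N. h k = lid l k} \<subseteq> G" using G unfolding open_subgroup_of_def by blast
  have NMat: "N \<subseteq> Matl l" using N normalizer_GL2 GL2_Matl by blast
  define cos where "cos g = lmul l g ` G" for g
  define red where "red i S = (\<lambda>A. A i) ` S" for i :: nat and S :: "(nat \<Rightarrow> mat2) set"
  define cosn where "cosn i g = (\<lambda>h. redm (int l ^ i) (mul2 g h)) ` img G i" for i g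
  have red_cos: "red i (cos g) = cosn i (g i)" for i g
    unfolding red_def cos_def cosn_def img_def image_image lmul_def ..
  have cos_lmul: "cos (lmul l g u) = cos g" if "u \<in> G" for g u
  proof
    show "cos (lmul l g u) \<subseteq> cos g"
      unfolding cos_def using Gm[OF that] by (auto simp: lmul_assoc)
    obtain u' where u': "u' \<in> G" "lmul l u u' = lid l" using Gi[OF \<open>u \<in> G\<close>] by blast
    show "cos g \<subseteq> cos (lmul l g u)"
    proof
      fix x assume "x \<in> cos g"
      then obtain v where v: "v \<in> G" "x = lmul l g v" unfolding cos_def by blast
      have "lmul l (lmul l g u) (lmul l u' v) = lmul l g (lmul l (lmul l u u') v)"
        by (simp only: lmul_assoc)
      also have "\<dots> = x" unfolding u'(2) using v GN NMat by (auto simp: lmul_lid)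
      finally show "x \<in> cos (lmul l g u)" unfolding cos_def using Gm[OF u'(1) v(1)] by blast
    qed
  qed
  \<comment> \<open>Openness at level k makes cosets distinguishable from level k on: if h and gu
    agree there, then the quotient w reduces to the identity and lies in G.\<close>
  have inj: "inj_on (red i) (cos ` N)" if "i \<ge> k" for i
  proof (rule inj_onI)
    fix S T assume "S \<in> cos ` N" "T \<in> cos ` N" and eq: "red i S = red i T"
    then obtain g h where gh: "g \<in> N" "h \<in> N" "S = cos g" "T = cos h" by blast
    have "h = lmul l h (lid l)" using lmul_lid(2) gh NMat by auto
    hence "h i \<in> red i (cos h)" unfolding red_def cos_def using lidG by blast
    hence "h i \<in> red i (cos g)" using eq gh by simp
    then obtain u where u: "u \<in> G" "h i = lmul l g u i" unfolding red_def cos_def by blast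
    have guN: "lmul l g u \<in> N" using normalizer_mult gh(1) u(1) GN unfolding N by blast
    then obtain z where z: "z \<in> N" "lmul l (lmul l g u) z = lid l" "lmul l z (lmul l g u) = lid l"
      using normalizer_inverse[OF C] unfolding N by blast
    define w where "w = lmul l z h"
    have "w \<in> N" unfolding w_def using normalizer_mult z(1) gh(2) unfolding N by blast
    moreover have "w i = lid l i"
      unfolding w_def using fun_cong[OF z(3), of i] u(2) by (simp add: lmul_def)
    hence "w k = lid l k"
      using Matl_eq_le[OF _ lid_in_Matl _ that] \<open>w \<in> N\<close> NMat by blast
    ultimately have "w \<in> G" using k by blast
    have "lmul l (lmul l g u) w = lmul l (lid l) h"
      unfolding w_def z(2)[symmetric] by (simp only: lmul_assoc)
    also have "\<dots> = h" using gh(2) NMat lmul_lid(1) by blast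
    finally have "cos h = cos g" using cos_lmul[OF \<open>w \<in> G\<close>] cos_lmul[OF u(1)] by metis
    thus "S = T" using gh by simp
  qed
  have img: "cosn i ` img N i = red i ` (cos ` N)" for i
    unfolding image_image red_cos img_def ..
  have index_n: "index_n l i (img N i) (img G i) = card (red i ` (cos ` N))" for i
    unfolding index_n_def cosn_def[symmetric] img ..
  have index_l: "index_l l N G = card (cos ` N)"
    unfolding index_l_def cos_def ..
  define m where "m = (LEAST n. 0 < n \<and> index_n l n (img N n) (img G n) = index_l l N G)"
  \<comment> \<open>The least index in \<open>level\<close> ranges over positive numbers, hence the
    maximum with 1.\<close>
  have "0 < max k 1 \<and> index_n l (max k 1) (img N (max k 1)) (img G (max k 1)) = index_l l N G"
    unfolding index_n index_l using card_image[OF inj[of "max k 1"]] by simp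
  hence m: "index_n l m (img N m) (img G m) = index_l l N G"
    unfolding m_def by (rule LeastI2) blast
  \<comment> \<open>Equal cardinalities give injectivity only for finite sets. Finiteness follows
    from injectivity at level k, where the image is finite.\<close>
  have fin: "finite (cos ` N)"
  proof (rule finite_imageD[OF _ inj[of k]])
    show "finite (red k ` (cos ` N))"
      unfolding img[symmetric] by (rule finite_imageI[OF finite_img[OF NMat]])
  qed simp
  have injm: "inj_on (red m) (cos ` N)"
    using m fin unfolding index_n index_l by (intro eq_card_imp_inj_on)
  have "m \<le> n" using n unfolding level_def Let_def m_def[symmetric] by (simp split: if_splits)
  hence "h m = lid l m" using Matl_eq_le[of h l "lid l" n m] lid_in_Matl h NMat by blast
  hence "red m (cos h) = red m (cos (lid l))" unfolding red_cos by simp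
  moreover have "lid l \<in> N" using lidG GN by blast
  ultimately have "cos h = cos (lid l)" using injm h(1) by (meson imageI inj_onD)
  moreover have "h = lmul l h (lid l)" using lmul_lid(2) h(1) NMat by auto
  hence "h \<in> cos h" unfolding cos_def using lidG by blast
  ultimately obtain v where "v \<in> G" "h = lmul l (lid l) v" unfolding cos_def by blast
  thus ?thesis using GN NMat lmul_lid(1) by auto
qed

text \<open>Apply \<open>level_kernel\<close> to the product of the inverse of M with M'.\<close>

lemma level_lift:
  assumes C: "C \<subseteq> Matl l" and N: "N = normalizer l C" and G: "open_subgroup_of l G N"
    and n: "n \<ge> level l N G" and M: "M \<in> G" "M' \<in> N" "M' n = M n"
  shows "M' \<in> G"
proof -
  have GN: "G \<subseteq> N" and Gm: "\<And>g h. g \<in> G \<Longrightarrow> h \<in> G \<Longrightarrow> lmul l g h \<in> G"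
    using G unfolding open_subgroup_of_def by auto
  obtain Z where Z: "Z \<in> N" "lmul l M Z = lid l" "lmul l Z M = lid l"
    using normalizer_inverse[OF C, of M] M(1) GN unfolding N by blast
  have "lmul l Z M' \<in> G"
  proof (rule level_kernel[OF C N G n])
    show "lmul l Z M' \<in> N" using normalizer_mult Z(1) M(2) unfolding N by blast
    show "lmul l Z M' n = lid l n"
      using fun_cong[OF Z(3), of n] M(3) by (simp add: lmul_def)
  qed
  hence "lmul l M (lmul l Z M') \<in> G" by (rule Gm[OF M(1)])
  also have "lmul l M (lmul l Z M') = lmul l (lid l) M'"
    unfolding Z(2)[symmetric] by (simp only: lmul_assoc)
  also have "\<dots> = M'" using M(2) N normalizer_GL2 GL2_Matl lmul_lid(1) by blast
  finally show ?thesis .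
qed

end

subsection \<open>Lifting elements outside the Cartan subgroup\<close>

context cartan begin

text \<open>The number of digits of det (M - I) beyond the n-th that M modulo \<open>l ^ n\<close>
  determines.\<close>

definition eps :: nat where "eps = (if l = 2 then 1 else 0)"

lemma sub2_cj: "redm (int l ^ n) (sub2 (cj F n) id2) = cj (\<lambda>n. sub2 (F n) id2) n"
proof -
  have dist: "mul2 A (mul2 (sub2 B id2) D) = sub2 (mul2 A (mul2 B D)) (mul2 A D)" for A B D
    by (cases A; cases B; cases D) (simp add: id2_def algebra_simps)
  have sub: "redm m (sub2 A B) = redm m (sub2 A' B')" if "redm m A = redm m A'" "redm m B = redm m B'"
    for m A B A' B'
    using that by (cases A; cases A'; cases B; cases B') (auto simp: cong_def[symmetric] intro!: cong_diff)
  show ?thesis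
    unfolding cj_apply dist by (rule sub) (simp_all only: redm_idem redm_PQ)
qed

lemma cj_id: "cj (\<lambda>n. id2) = lid l"
  by (rule ext) (simp add: cj_apply redm_PQ lid_def)

lemma twist_det_dvd:
  assumes "coh x" "coh y" "M = cj (\<lambda>n. tw n (x n) (y n))" "j \<le> k"
  shows "det_dvd M j \<longleftrightarrow> int l ^ j dvd 1 - nm k (x k) (y k)"
proof -
  have "M \<in> Matl l" unfolding assms(3) by (rule cj_in_Matl[OF tw_coherent[OF assms(1,2)]])
  hence "det_dvd M j \<longleftrightarrow> int l ^ j dvd det2 (sub2 (M k) id2)" using assms(4) by (rule det_dvd_level)
  also have "\<dots> \<longleftrightarrow> int l ^ j dvd det2 (sub2 (tw k (x k) (y k)) id2)"
  proof -
    have "det2 (sub2 (M k) id2) mod int l ^ k = det2 (cj (\<lambda>n. sub2 (tw n (x n) (y n)) id2) k) mod int l ^ k"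
      unfolding sub2_cj[symmetric] assms(3) by (rule det2_redm) (simp only: redm_idem)
    also have "\<dots> = det2 (sub2 (tw k (x k) (y k)) id2) mod int l ^ k" by (rule det2_cj)
    finally show ?thesis
      using assms(4) by (metis dvd_mod_iff le_imp_power_dvd)
  qed
  also have "det2 (sub2 (tw k (x k) (y k)) id2) = 1 - nm k (x k) (y k)"
    by (simp add: tw_def id2_def nm_def algebra_simps power2_eq_square)
  finally show ?thesis .
qed

text \<open>A twisted element has trace 0 and the identity has trace 2.\<close>

lemma twist_id_mod:
  assumes "M \<in> twist" "id_mod M j"
  shows "int l ^ j dvd 2"
proof -
  obtain x y where M: "M = cj (\<lambda>n. tw n (x n) (y n))"
    using assms(1) by (rule twistE)
  have "redm (int l ^ j) (tw j (x j) (y j)) = redm (int l ^ j) id2"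
    using assms(2) cj_eq_iff[of "\<lambda>n. tw n (x n) (y n)" j "\<lambda>n. id2"] unfolding id_mod_def M cj_id by blast
  hence "int l ^ j dvd x j - 1" "int l ^ j dvd - x j - 1"
    unfolding tw_def id2_def redm_eq_iff by blast+
  hence "int l ^ j dvd (x j - 1) + (- x j - 1)" by (rule dvd_add)
  thus ?thesis by simp
qed

text \<open>The Taylor expansion of the norm form; the linear coefficients are its partial
  derivatives.\<close>

lemma nm_shift:
  "nm k (x + h * u) (y + h * v) =
   nm k x y + h * ((2 * x + t k * y) * u + (t k * x + 2 * d k * y) * v) + h\<^sup>2 * nm k u v"
  by (simp add: nm_def algebra_simps power2_eq_square)

text \<open>The partial derivatives of the norm form are divisible by 2 when \<open>l = 2\<close>;
  this is the reason why the determinant is well defined to one more digit in that case.\<close>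
lemma nm_deriv:
  assumes "k \<ge> 1" "\<not> int l dvd nm k x y"
  obtains \<alpha> \<beta> where "2 * x + t k * y = int l ^ eps * \<alpha>" "t k * x + 2 * d k * y = int l ^ eps * \<beta>"
    "\<not> int l dvd \<alpha> \<or> \<not> int l dvd \<beta>"
proof -
  have "coh (\<lambda>n. (t n)\<^sup>2 - 4 * d n)" using coh_t coh_d by simp
  hence ramk: "int l dvd (t k)\<^sup>2 - 4 * d k"
    using coh_dvd_iff[of "\<lambda>n. (t n)\<^sup>2 - 4 * d n" 1 1 k] assms(1) ram by simp
  show ?thesis
  proof (cases "l = 2")
    case True
    have e2: "int l ^ eps = 2" unfolding eps_def using True by simp
    have "even ((t k)\<^sup>2 - 4 * d k)" using ramk True by simp
    hence "even (t k)" by simp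
    then obtain s where s: "t k = 2 * s" by blast
    \<comment> \<open>Euler's relation for the quadratic form: a common factor of the halved
      derivatives would divide the norm.\<close>
    have "nm k x y = x * (x + s * y) + y * (s * x + d k * y)"
      by (simp add: nm_def s algebra_simps power2_eq_square)
    hence "\<not> int l dvd x + s * y \<or> \<not> int l dvd s * x + d k * y"
      using assms(2) by (metis dvd_add dvd_mult)
    moreover have "2 * x + t k * y = int l ^ eps * (x + s * y)" "t k * x + 2 * d k * y = int l ^ eps * (s * x + d k * y)"
      by (simp_all add: s e2 algebra_simps)
    ultimately show ?thesis using that by blast
  next
    case False
    have "\<not> int l dvd 2 * x + t k * y"
    proof
      assume *: "int l dvd 2 * x + t k * y"
      \<comment> \<open>Completing the square; ramification makes the discriminant term vanish
        modulo l.\<close>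
      have "4 * nm k x y = (2 * x + t k * y) * (2 * x + t k * y) - ((t k)\<^sup>2 - 4 * d k) * y\<^sup>2"
        by (simp add: nm_def algebra_simps power2_eq_square)
      also have "int l dvd \<dots>" by (rule dvd_diff[OF dvd_mult2[OF *] dvd_mult2[OF ramk]])
      finally have "int l dvd 2 * (2 * nm k x y)" by simp
      hence "int l dvd 2 \<or> int l dvd nm k x y" using prime_dvd_mult_iff[OF prime_int_l] by blast
      hence "int l dvd int 2" using assms(2) by simp
      hence "l dvd 2" by (simp only: int_dvd_int_iff)
      thus False using False prime_l primes_dvd_imp_eq two_is_prime_nat by blast
    qed
    moreover have "2 * x + t k * y = int l ^ eps * (2 * x + t k * y)"
       "t k * x + 2 * d k * y = int l ^ eps * (t k * x + 2 * d k * y)"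
      using False by (simp_all add: eps_def)
    ultimately show ?thesis using that by blast
  qed
qed

lemma twist_nm_unit:
  assumes "coh x" "coh y" "cj (\<lambda>n. tw n (x n) (y n)) \<in> GL2 l" "k \<ge> 1"
  shows "\<not> int l dvd nm k (x k) (y k)"
proof -
  have "\<not> int l dvd nm 1 (x 1) (y 1)"
    using assms(3) cj_in_GL2_iff[OF tw_coherent[OF assms(1,2)]] by (simp add: det2_tw)
  moreover have "coh (\<lambda>n. nm n (x n) (y n))"
    unfolding nm_def using assms coh_t coh_d by simp
  ultimately show ?thesis
    using coh_dvd_iff[of "\<lambda>n. nm n (x n) (y n)" 1 1 k] assms(4) by simp
qed

lemma tw_eq_iff:
  "redm (int l ^ k) (tw k x y) = redm (int l ^ k) (tw k x' y') \<longleftrightarrow>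
    int l ^ k dvd x - x' \<and> int l ^ k dvd y - y'"
proof
  assume *: "int l ^ k dvd x - x' \<and> int l ^ k dvd y - y'"
  have "t k * x + d k * y - (t k * x' + d k * y') = t k * (x - x') + d k * (y - y')"
    "- x - - x' = - (x - x')"
    by (simp_all add: algebra_simps)
  moreover have "int l ^ k dvd t k * (x - x') + d k * (y - y')"
    using * by (intro dvd_add dvd_mult) simp_all
  ultimately show "redm (int l ^ k) (tw k x y) = redm (int l ^ k) (tw k x' y')"
    using * unfolding tw_def redm_eq_iff by (metis dvd_minus_iff)
qed (unfold tw_def redm_eq_iff, blast)

lemma twist_congE:
  assumes x: "coh x" "coh y" "M = cj (\<lambda>n. tw n (x n) (y n))"
    and x': "coh x'" "coh y'" "M' = cj (\<lambda>n. tw n (x' n) (y' n))"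
    and "M n = M' n" "n \<le> k"
  obtains u v where "x' k = x k + int l ^ n * u" "y' k = y k + int l ^ n * v"
proof -
  have "int l ^ n dvd x' n - x n" "int l ^ n dvd y' n - y n"
    using assms(7) unfolding x(3) x'(3) cj_eq_iff tw_eq_iff by (simp_all add: dvd_diff_commute)
  hence "int l ^ n dvd x' k - x k" "int l ^ n dvd y' k - y k"
    using coh_dvd_iff[OF coh_diff[OF x'(1) x(1)], of n n k] coh_dvd_iff[OF coh_diff[OF x'(2) x(2)], of n n k]
      assms(8) by simp_all
  then obtain u v where "x' k - x k = int l ^ n * u" "y' k - y k = int l ^ n * v" unfolding dvd_def by blast
  hence "x' k = x k + int l ^ n * u" "y' k = y k + int l ^ n * v" by simp_all
  thus ?thesis by (rule that)
qed

text \<open>In \<open>nm_shift\<close> with step \<open>l ^ n\<close>, the derivatives supply a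
  further \<open>l ^ eps\<close>, so the norm changes by a multiple of
  \<open>l ^ (n + eps)\<close>.\<close>

lemma det_dvd_same_level:
  assumes "M \<in> twist" "M' \<in> twist" "M n = M' n" "n \<ge> 1" "j \<le> n + eps"
  shows "det_dvd M j \<longleftrightarrow> det_dvd M' j"
proof -
  obtain x y where x: "coh x" "coh y" "M = cj (\<lambda>n. tw n (x n) (y n))" and MG: "M \<in> GL2 l"
    using assms(1) by (rule twistE)
  obtain x' y' where x': "coh x'" "coh y'" "M' = cj (\<lambda>n. tw n (x' n) (y' n))"
    using assms(2) by (rule twistE)
  define k where "k = n + eps"
  have nk: "n \<le> k" and jk: "j \<le> k" using assms(5) by (simp_all add: k_def)
  obtain u v where uv: "x' k = x k + int l ^ n * u" "y' k = y k + int l ^ n * v"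
    by (rule twist_congE[OF x x' assms(3) nk])
  have k1: "k \<ge> 1" using assms(4) nk by simp
  have "\<not> int l dvd nm k (x k) (y k)"
    using twist_nm_unit[OF x(1,2) _ k1] MG x(3) by simp
  then obtain \<alpha> \<beta> where \<alpha>: "2 * x k + t k * y k = int l ^ eps * \<alpha>" "t k * x k + 2 * d k * y k = int l ^ eps * \<beta>"
    by (rule nm_deriv[OF k1])
  \<comment> \<open>The quadratic term is harmless since n + eps \<le> 2n for n \<ge> 1.\<close>
  have "int l ^ k dvd (int l ^ n)\<^sup>2"
    unfolding power_mult[symmetric] using assms(4) by (intro le_imp_power_dvd) (simp add: k_def eps_def)
  moreover have "nm k (x' k) (y' k) - nm k (x k) (y k) =
     int l ^ k * (\<alpha> * u + \<beta> * v) + (int l ^ n)\<^sup>2 * nm k u v"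
    unfolding uv nm_shift \<alpha> by (simp add: k_def power_add algebra_simps)
  ultimately have "int l ^ k dvd nm k (x' k) (y' k) - nm k (x k) (y k)"
    by (simp only: dvd_add dvd_triv_left dvd_mult2)
  hence d: "int l ^ j dvd nm k (x' k) (y' k) - nm k (x k) (y k)"
    using jk by (meson dvd_trans le_imp_power_dvd)
  have "1 - nm k (x k) (y k) = (1 - nm k (x' k) (y' k)) + (nm k (x' k) (y' k) - nm k (x k) (y k))" by simp
  thus ?thesis unfolding twist_det_dvd[OF x jk] twist_det_dvd[OF x' jk] using d by (metis dvd_add_left_iff)
qed

text \<open>The solutions form a line in the plane over the field with l elements: the variable with
  unit coefficient is a function of the other one.\<close>

lemma card_linear_congruence:
  assumes "\<not> int l dvd \<alpha> \<or> \<not> int l dvd \<beta>"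
  shows "card {(u,v) \<in> {0..<int l} \<times> {0..<int l}. int l dvd e - (\<alpha> * u + \<beta> * v)} = l"
proof -
  have one: "\<exists>!u. u \<in> {0..<int l} \<and> int l dvd e - (\<alpha> * u + w)" if "\<not> int l dvd \<alpha>" for \<alpha> e w
  proof -
    have cop: "coprime \<alpha> (int l)" using coprime_power_l[OF that, of 1] by simp
    then obtain i where "[\<alpha> * i = 1] (mod int l)" using cong_solve_coprime_int by blast
    then obtain z where z: "\<alpha> * i = 1 + int l * z" by (auto simp: cong_iff_dvd_diff dvd_def algebra_simps)
    define u where "u = (i * (e - w)) mod int l"
    have u: "u = i * (e - w) - int l * ((i * (e - w)) div int l)"
      unfolding u_def by (simp add: minus_mult_div_eq_mod)
    hence "e - (\<alpha> * u + w) = e - w - (\<alpha> * i) * (e - w) + int l * (\<alpha> * ((i * (e - w)) div int l))"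
      by (subst u) (simp add: algebra_simps)
    also have "\<dots> = int l * (\<alpha> * ((i * (e - w)) div int l) - z * (e - w))"
      unfolding z by (simp add: algebra_simps)
    finally have "int l dvd e - (\<alpha> * u + w)" by simp
    moreover have "u \<in> {0..<int l}" using l_gt_1 by (simp add: u_def)
    moreover have "u1 = u2" if "u1 \<in> {0..<int l} \<and> int l dvd e - (\<alpha> * u1 + w)"
      "u2 \<in> {0..<int l} \<and> int l dvd e - (\<alpha> * u2 + w)" for u1 u2
    proof -
      have "int l dvd (e - (\<alpha> * u2 + w)) - (e - (\<alpha> * u1 + w))" by (rule dvd_diff) (use that in blast)+
      also have "\<dots> = \<alpha> * (u1 - u2)" by (simp add: algebra_simps)
      finally have "int l dvd u1 - u2"
        using cop by (metis coprime_commute coprime_dvd_mult_right_iff)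
      hence "u1 mod int l = u2 mod int l" by (simp add: mod_eq_dvd_iff)
      thus ?thesis using that by simp
    qed
    ultimately show ?thesis by blast
  qed
  show ?thesis
  proof (cases "int l dvd \<alpha>")
    case False
    define f where "f v = (THE u. u \<in> {0..<int l} \<and> int l dvd e - (\<alpha> * u + \<beta> * v))" for v
    have f: "u \<in> {0..<int l} \<and> int l dvd e - (\<alpha> * u + \<beta> * v) \<longleftrightarrow> u = f v" for u v
      using theI'[OF one[OF False, of e "\<beta> * v"]] one[OF False, of e "\<beta> * v"] unfolding f_def by blast
    have "{(u,v) \<in> {0..<int l} \<times> {0..<int l}. int l dvd e - (\<alpha> * u + \<beta> * v)} = (\<lambda>v. (f v, v)) ` {0..<int l}"
    proof (rule Set.set_eqI)
      fix p :: "int \<times> int"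
      obtain u v where p: "p = (u,v)" by (cases p)
      show "p \<in> {(u,v) \<in> {0..<int l} \<times> {0..<int l}. int l dvd e - (\<alpha> * u + \<beta> * v)} \<longleftrightarrow>
            p \<in> (\<lambda>v. (f v, v)) ` {0..<int l}"
        unfolding p image_iff using f[of u v] by auto
    qed
    also have "card \<dots> = card {0..<int l}" by (intro card_image inj_onI) simp
    finally show ?thesis by simp
  next
    case True
    hence \<beta>: "\<not> int l dvd \<beta>" using assms by blast
    define f where "f u = (THE v. v \<in> {0..<int l} \<and> int l dvd e - (\<beta> * v + \<alpha> * u))" for u
    have f: "v \<in> {0..<int l} \<and> int l dvd e - (\<beta> * v + \<alpha> * u) \<longleftrightarrow> v = f u" for u v
      using theI'[OF one[OF \<beta>, of e "\<alpha> * u"]] one[OF \<beta>, of e "\<alpha> * u"] unfolding f_def by blast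
    have "{(u,v) \<in> {0..<int l} \<times> {0..<int l}. int l dvd e - (\<alpha> * u + \<beta> * v)} = (\<lambda>u. (u, f u)) ` {0..<int l}"
    proof (rule Set.set_eqI)
      fix p :: "int \<times> int"
      obtain u v where p: "p = (u,v)" by (cases p)
      show "p \<in> {(u,v) \<in> {0..<int l} \<times> {0..<int l}. int l dvd e - (\<alpha> * u + \<beta> * v)} \<longleftrightarrow>
            p \<in> (\<lambda>u. (u, f u)) ` {0..<int l}"
        unfolding p image_iff using f[of v u] by (auto simp: add.commute)
    qed
    also have "card \<dots> = card {0..<int l}" by (intro card_image inj_onI) simp
    finally show ?thesis by simp
  qed
qed

text \<open>Lifts are taken among all twisted elements, that is in N - C. For M in G - C and n from
  the level on, they lie in G - C.\<close>

definition lifts :: "(nat \<Rightarrow> mat2) \<Rightarrow> nat \<Rightarrow> (nat \<Rightarrow> mat2) set" where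
  "lifts M n = {M' \<in> twist. M' n = M n}"

text \<open>The lifts are exhibited by adding \<open>l ^ n * u\<close> and \<open>l ^ n * v\<close>
  to the coordinates of M, and the condition on the next digit of the determinant is linear in (u,
  v).\<close>

lemma lifts_param:
  assumes M: "M \<in> twist" and n: "n \<ge> 1 + eps"
  shows "\<exists>\<phi>. inj_on (\<lambda>uv. \<phi> uv (Suc n)) ({0..<int l} \<times> {0..<int l}) \<and>
    (\<forall>uv. \<phi> uv \<in> lifts M n) \<and>
    (\<forall>M'\<in>lifts M n. \<exists>uv \<in> {0..<int l} \<times> {0..<int l}. M' (Suc n) = \<phi> uv (Suc n)) \<and>
    (det_dvd M (n + eps) \<longrightarrow>
      card {uv \<in> {0..<int l} \<times> {0..<int l}. det_dvd (\<phi> uv) (Suc (n + eps))} = l)"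
proof -
  obtain x y where x: "coh x" "coh y" "M = cj (\<lambda>n. tw n (x n) (y n))" and MG: "M \<in> GL2 l"
    using M by (rule twistE)
  define f where "f u k = x k + int l ^ n * u" for u k
  define g where "g v k = y k + int l ^ n * v" for v k
  define \<phi> where "\<phi> = (\<lambda>(u,v). cj (\<lambda>k. tw k (f u k) (g v k)))"
  have coh: "coh (f u)" "coh (g u)" for u
    unfolding f_def g_def using x by simp_all
  have "int l dvd int l ^ n" using n by simp
  have \<phi>_lift: "\<phi> (u,v) \<in> lifts M n" for u v
  proof -
    \<comment> \<open>The norm changes by a multiple of l, so the shifted element remains
      invertible.\<close>
    have "nm 1 (f u 1) (g v 1) = nm 1 (x 1) (y 1) + int l ^ n *
        ((2 * x 1 + t 1 * y 1) * u + (t 1 * x 1 + 2 * d 1 * y 1) * v + int l ^ n * nm 1 u v)"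
      unfolding f_def g_def nm_shift by (simp add: algebra_simps power2_eq_square)
    hence "int l dvd nm 1 (f u 1) (g v 1) \<longleftrightarrow> int l dvd nm 1 (x 1) (y 1)"
      using \<open>int l dvd int l ^ n\<close> by (metis dvd_add_left_iff dvd_mult2)
    hence "\<phi> (u,v) \<in> GL2 l"
      using cj_in_GL2_iff[OF tw_coherent[OF coh(1)[of u] coh(2)[of v]]] twist_nm_unit[OF x(1,2), of 1] MG x(3)
      unfolding \<phi>_def det2_tw dvd_minus_iff by simp
    hence "\<phi> (u,v) \<in> twist" unfolding \<phi>_def using twistI[OF coh(1)[of u] coh(2)[of v]] by simp
    moreover have "\<phi> (u,v) n = M n"
      unfolding \<phi>_def x(3) prod.case cj_eq_iff tw_eq_iff f_def g_def by simp
    ultimately show ?thesis by (simp add: lifts_def)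
  qed
  have \<phi>_eq: "\<phi> (u,v) (Suc n) = \<phi> (u',v') (Suc n) \<longleftrightarrow> int l dvd u - u' \<and> int l dvd v - v'" for u v u' v'
  proof -
    have "f u (Suc n) - f u' (Suc n) = int l ^ n * (u - u')" "g v (Suc n) - g v' (Suc n) = int l ^ n * (v - v')"
      unfolding f_def g_def by (simp_all add: algebra_simps)
    thus ?thesis using l_nz unfolding \<phi>_def prod.case cj_eq_iff tw_eq_iff by (simp add: power_Suc2)
  qed
  show ?thesis
  proof (rule exI[of _ \<phi>], intro conjI allI ballI impI)
    show "inj_on (\<lambda>uv. \<phi> uv (Suc n)) ({0..<int l} \<times> {0..<int l})"
    proof (rule inj_onI)
      fix p q assume "p \<in> {0..<int l} \<times> {0..<int l}" "q \<in> {0..<int l} \<times> {0..<int l}" and eq: "\<phi> p (Suc n) = \<phi> q (Suc n)"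
      then obtain u v u' v' where pq: "p = (u,v)" "q = (u',v')" and b: "0 \<le> u" "u < int l" "0 \<le> v" "v < int l"
        "0 \<le> u'" "u' < int l" "0 \<le> v'" "v' < int l" by auto
      have "u mod int l = u' mod int l" "v mod int l = v' mod int l"
        using eq unfolding pq \<phi>_eq mod_eq_dvd_iff by blast+
      thus "p = q" using b unfolding pq by simp
    qed
    show "\<phi> uv \<in> lifts M n" for uv using \<phi>_lift by (cases uv) simp
    show "\<exists>uv \<in> {0..<int l} \<times> {0..<int l}. M' (Suc n) = \<phi> uv (Suc n)" if "M' \<in> lifts M n" for M'
    proof -
      have M': "M' \<in> twist" "M n = M' n" using that by (simp_all add: lifts_def)
      obtain x' y' where x': "coh x'" "coh y'" "M' = cj (\<lambda>n. tw n (x' n) (y' n))"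
        using M'(1) by (rule twistE)
      obtain u v where uv: "x' (Suc n) = x (Suc n) + int l ^ n * u" "y' (Suc n) = y (Suc n) + int l ^ n * v"
        by (rule twist_congE[OF x x' M'(2), of "Suc n"]) simp
      have "M' (Suc n) = \<phi> (u,v) (Suc n)"
        unfolding x'(3) \<phi>_def prod.case cj_eq_iff tw_eq_iff f_def g_def uv by simp
      also have "\<dots> = \<phi> (u mod int l, v mod int l) (Suc n)"
        unfolding \<phi>_eq by (simp add: minus_mod_eq_mult_div)
      finally show ?thesis using l_gt_1 by (intro bexI[of _ "(u mod int l, v mod int l)"]) auto
    qed
    assume dvM: "det_dvd M (n + eps)"
    define e where "e = n + eps"
    define k where "k = Suc e"
    have k1: "k \<ge> 1" by (simp add: k_def)
    have "\<not> int l dvd nm k (x k) (y k)"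
      using twist_nm_unit[OF x(1,2), of k] MG x(3) k1 by simp
    then obtain \<alpha> \<beta> where \<alpha>: "2 * x k + t k * y k = int l ^ eps * \<alpha>" "t k * x k + 2 * d k * y k = int l ^ eps * \<beta>"
      and unit: "\<not> int l dvd \<alpha> \<or> \<not> int l dvd \<beta>"
      by (rule nm_deriv[OF k1])
    have "int l ^ e dvd 1 - nm k (x k) (y k)"
      using dvM twist_det_dvd[OF x, of e k] by (simp add: k_def e_def)
    then obtain w where w: "1 - nm k (x k) (y k) = int l ^ e * w" by blast
    \<comment> \<open>Here n + eps + 1 \<le> 2n is required, which is exactly the hypothesis n \<ge>
      1 + eps.\<close>
    have sq: "int l ^ k dvd (int l ^ n)\<^sup>2"
      unfolding power_mult[symmetric] using n by (intro le_imp_power_dvd) (simp add: k_def e_def)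
    have "det_dvd (\<phi> (u,v)) k \<longleftrightarrow> int l dvd w - (\<alpha> * u + \<beta> * v)" for u v
    proof -
      have "det_dvd (\<phi> (u,v)) k \<longleftrightarrow> int l ^ k dvd 1 - nm k (f u k) (g v k)"
        by (rule twist_det_dvd[OF coh(1)[of u] coh(2)[of v]]) (simp_all add: \<phi>_def)
      also have "1 - nm k (f u k) (g v k) = int l ^ e * (w - (\<alpha> * u + \<beta> * v)) - (int l ^ n)\<^sup>2 * nm k u v"
      proof -
        have "1 - nm k (f u k) (g v k) = (1 - nm k (x k) (y k)) - int l ^ n * (int l ^ eps * \<alpha> * u + int l ^ eps * \<beta> * v)
           - (int l ^ n)\<^sup>2 * nm k u v"
          unfolding f_def g_def nm_shift \<alpha> by simp
        thus ?thesis unfolding w by (simp add: e_def power_add algebra_simps)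
      qed
      also have "int l ^ k dvd \<dots> \<longleftrightarrow> int l ^ k dvd int l ^ e * (w - (\<alpha> * u + \<beta> * v))"
        using dvd_mult2[OF sq, of "nm k u v"] by (metis dvd_diff_left_iff)
      also have "\<dots> \<longleftrightarrow> int l dvd w - (\<alpha> * u + \<beta> * v)"
        using l_nz unfolding k_def power_Suc2 by simp
      finally show ?thesis .
    qed
    hence "{uv \<in> {0..<int l} \<times> {0..<int l}. det_dvd (\<phi> uv) k} =
      {(u,v) \<in> {0..<int l} \<times> {0..<int l}. int l dvd w - (\<alpha> * u + \<beta> * v)}" by auto
    thus "card {uv \<in> {0..<int l} \<times> {0..<int l}. det_dvd (\<phi> uv) (Suc (n + eps))} = l"
      using card_linear_congruence[OF unit] unfolding k_def e_def by simp
  qed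
qed

text \<open>The determinant condition depends only on the reduction modulo
  \<open>l ^ (n + 1)\<close>, so the count of pairs (u, v) is a count of reduced matrices.\<close>

lemma card_lifts:
  assumes M: "M \<in> twist" and n: "n \<ge> 1 + eps"
  shows "card (img (lifts M n) (Suc n)) = l\<^sup>2"
    and "det_dvd M (n + eps) \<Longrightarrow> card (img {M' \<in> lifts M n. det_dvd M' (Suc (n + eps))} (Suc n)) = l"
    and "det_dvd M (n + eps) \<Longrightarrow> card (img {M' \<in> lifts M n. \<not> det_dvd M' (Suc (n + eps))} (Suc n)) = l * (l - 1)"
proof -
  let ?S = "{0..<int l} \<times> {0..<int l}"
  obtain \<phi> where inj: "inj_on (\<lambda>uv. \<phi> uv (Suc n)) ?S" and \<phi>: "\<And>uv. \<phi> uv \<in> lifts M n"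
    "\<And>M'. M' \<in> lifts M n \<Longrightarrow> \<exists>uv \<in> ?S. M' (Suc n) = \<phi> uv (Suc n)"
    and det_dvd: "det_dvd M (n + eps) \<Longrightarrow> card {uv \<in> ?S. det_dvd (\<phi> uv) (Suc (n + eps))} = l"
    using lifts_param[OF assms] by (elim exE conjE) blast
  have cS: "card ?S = l\<^sup>2" "finite ?S" by (simp_all add: card_cartesian_product power2_eq_square)
  have same: "det_dvd M1 (Suc (n + eps)) \<longleftrightarrow> det_dvd M2 (Suc (n + eps))"
    if "M1 \<in> lifts M n" "M2 \<in> lifts M n" "M1 (Suc n) = M2 (Suc n)" for M1 M2
    using that det_dvd_same_level[of M1 M2 "Suc n" "Suc (n + eps)"] by (simp add: lifts_def)
  \<comment> \<open>The predicate R on truth values treats all lifts, those with vanishing next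
    digit and those with nonvanishing next digit at once.\<close>
  have img: "img {M' \<in> lifts M n. R (det_dvd M' (Suc (n + eps)))} (Suc n) =
      (\<lambda>uv. \<phi> uv (Suc n)) ` {uv \<in> ?S. R (det_dvd (\<phi> uv) (Suc (n + eps)))}" for R
  proof (intro equalityI subsetI)
    fix A assume "A \<in> img {M' \<in> lifts M n. R (det_dvd M' (Suc (n + eps)))} (Suc n)"
    then obtain M' where M': "M' \<in> lifts M n" "R (det_dvd M' (Suc (n + eps)))" "A = M' (Suc n)"
      unfolding img_def by blast
    obtain uv where uv: "uv \<in> ?S" "M' (Suc n) = \<phi> uv (Suc n)" using \<phi>(2)[OF M'(1)] by blast
    have "R (det_dvd (\<phi> uv) (Suc (n + eps)))" using M'(2) same[OF M'(1) \<phi>(1) uv(2)] by simp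
    thus "A \<in> (\<lambda>uv. \<phi> uv (Suc n)) ` {uv \<in> ?S. R (det_dvd (\<phi> uv) (Suc (n + eps)))}"
      using uv M'(3) by blast
  next
    fix A assume "A \<in> (\<lambda>uv. \<phi> uv (Suc n)) ` {uv \<in> ?S. R (det_dvd (\<phi> uv) (Suc (n + eps)))}"
    thus "A \<in> img {M' \<in> lifts M n. R (det_dvd M' (Suc (n + eps)))} (Suc n)"
      unfolding img_def using \<phi>(1) by blast
  qed
  have cimg: "card (img {M' \<in> lifts M n. R (det_dvd M' (Suc (n + eps)))} (Suc n)) =
     card {uv \<in> ?S. R (det_dvd (\<phi> uv) (Suc (n + eps)))}" for R
    unfolding img by (rule card_image[OF inj_on_subset[OF inj]]) blast
  show "card (img (lifts M n) (Suc n)) = l\<^sup>2"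
    using cimg[of "\<lambda>_. True"] cS by simp
  assume dvM: "det_dvd M (n + eps)"
  show "card (img {M' \<in> lifts M n. det_dvd M' (Suc (n + eps))} (Suc n)) = l"
    using cimg[of "\<lambda>z. z"] det_dvd[OF dvM] by simp
  have "{uv \<in> ?S. \<not> det_dvd (\<phi> uv) (Suc (n + eps))} = ?S - {uv \<in> ?S. det_dvd (\<phi> uv) (Suc (n + eps))}" by blast
  hence "card {uv \<in> ?S. \<not> det_dvd (\<phi> uv) (Suc (n + eps))} = l\<^sup>2 - l"
    using card_Diff_subset[of "{uv \<in> ?S. det_dvd (\<phi> uv) (Suc (n + eps))}" ?S] cS det_dvd[OF dvM] by simp
  thus "card (img {M' \<in> lifts M n. \<not> det_dvd M' (Suc (n + eps))} (Suc n)) = l * (l - 1)"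
    using cimg[of Not] by (simp add: power2_eq_square diff_mult_distrib2)
qed

section \<open>The conditions defining \<open>Nab\<close> in terms of digits\<close>

lemma id_mod_0: "M \<in> Matl l \<Longrightarrow> id_mod M 0"
  by (cases "M 0") (simp add: id_mod_level[of M 0 0] id2_def)

text \<open>Excludes M = I, as \<open>kerMI_iso_iff\<close> requires.\<close>

lemma twist_not_id_mod_2:
  assumes "M \<in> twist" shows "\<not> id_mod M 2"
proof
  assume "id_mod M 2"
  hence "int l ^ 2 dvd 2" by (rule twist_id_mod[OF assms])
  hence "int l ^ 2 \<le> 2" by (rule zdvd_imp_le) simp
  moreover have "2 ^ 2 \<le> int l ^ 2" using l_gt_1 by (intro power_mono) simp_all
  ultimately show False by simp
qed

lemma twist_not_id_mod_1:
  assumes "M \<in> twist" "l \<noteq> 2" shows "\<not> id_mod M 1"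
proof
  assume "id_mod M 1"
  hence "int l dvd int 2" using twist_id_mod[OF assms(1), of 1] by simp
  hence "l dvd 2" by (simp only: int_dvd_int_iff)
  thus False using assms(2) prime_l primes_dvd_imp_eq two_is_prime_nat by blast
qed

text \<open>As b < e, both powers of l divide D exactly when they divide its residue; a zero residue
  is excluded on both sides.\<close>

lemma val_eq_mod_iff:
  assumes "b < e"
  shows "val_eq l (D mod int l ^ e) b \<longleftrightarrow> int l ^ b dvd D \<and> \<not> int l ^ Suc b dvd D"
proof -
  have dvd: "int l ^ j dvd D mod int l ^ e \<longleftrightarrow> int l ^ j dvd D" if "j \<le> e" for j
    using that by (simp add: dvd_mod_iff le_imp_power_dvd)
  have "val_eq l (D mod int l ^ e) b \<longleftrightarrow>
        int l ^ b dvd D mod int l ^ e \<and> \<not> int l ^ Suc b dvd D mod int l ^ e"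
  proof (cases "D mod int l ^ e = 0")
    case False
    have "\<not> is_unit (int l)" using l_gt_1 by simp
    hence mult: "int l ^ j dvd D mod int l ^ e \<longleftrightarrow> j \<le> multiplicity (int l) (D mod int l ^ e)" for j
      using False by (intro power_dvd_iff_le_multiplicity) auto
    show ?thesis unfolding val_eq_def mult using False by auto
  qed (simp add: val_eq_def)
  thus ?thesis using dvd[of b] dvd[of "Suc b"] assms by (simp del: power_Suc)
qed

text \<open>The conditions defining \<open>Nab\<close>, uniformly in \<open>l\<close>: the determinant
  of \<open>M - I\<close> is inspected modulo \<open>l ^ (n + eps)\<close>.\<close>
definition good :: "nat \<Rightarrow> nat \<Rightarrow> nat \<Rightarrow> (nat \<Rightarrow> mat2) \<Rightarrow> bool" where
  "good a b n M \<longleftrightarrow> id_mod M a \<and> \<not> id_mod M (Suc a) \<and> det_dvd M (min (n + eps) (2 * a + b)) \<and>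
     (2 * a + b < n + eps \<longrightarrow> \<not> det_dvd M (Suc (2 * a + b)))"

lemma det_dvd_val_iff:
  assumes "M \<in> Matl l" "e \<le> k"
  shows "(if e \<le> B then det2 (sub2 (M k) id2) mod int l ^ e = 0
          else val_eq l (det2 (sub2 (M k) id2) mod int l ^ e) B) \<longleftrightarrow>
         det_dvd M (min e B) \<and> (B < e \<longrightarrow> \<not> det_dvd M (Suc B))"
  using det_dvd_level[OF assms] det_dvd_level[OF assms(1), of B k] det_dvd_level[OF assms(1), of "Suc B" k] assms(2)
  by (auto simp: val_eq_mod_iff dvd_eq_mod_eq_0[symmetric] min_def)

lemma twist_Matl: "M \<in> twist \<Longrightarrow> M \<in> Matl l"
  by (simp add: twist_def GL2_def)

text \<open>As a < n, congruence to I modulo \<open>l ^ (a + 1)\<close> is visible at level n. For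
  odd l, a = 0 and a twisted element is never congruent to I modulo l, so the conditions on
  \<open>id_mod\<close> hold automatically. For l = 2, the representative inspected at level n + 1
  serves as the preimage.\<close>

lemma Nab_eq:
  assumes H: "G - cart \<subseteq> twist" and a: "l \<noteq> 2 \<longrightarrow> a = 0" "a < n"
  shows "Nab l G cart a b n = img {M \<in> G - cart. good a b n M} n"
proof (cases "l = 2")
  case False
  have "good a b n M \<longleftrightarrow> (if n \<le> b then det2 (sub2 (M n) id2) mod int l ^ n = 0
           else val_eq l (det2 (sub2 (M n) id2) mod int l ^ n) b)" if "M \<in> G - cart" for M
  proof -
    have M: "M \<in> twist" "M \<in> Matl l" using H that twist_Matl by auto
    have "eps = 0" unfolding eps_def using False by simp
    thus ?thesis
      unfolding good_def det_dvd_val_iff[OF M(2) order_refl]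
      using id_mod_0[OF M(2)] twist_not_id_mod_1[OF M(1) False] a(1) False by simp
  qed
  thus ?thesis unfolding Nab_def img_def using False by auto
next
  case True
  have i2: "int l = 2" using True by simp
  \<comment> \<open>Reconciles the threshold n + eps of \<open>good\<close> with the threshold n of
    \<open>Nab\<close> for l = 2.\<close>
  have le: "n + 1 \<le> 2 * a + b \<longleftrightarrow> n < 2 * a + b" by linarith
  have v2: "val_eq 2 = val_eq l" by (simp only: True)
  have e1: "eps = 1" unfolding eps_def using True by simp
  have good: "good a b n M \<longleftrightarrow> redm (2 ^ a) (sub2 (M n) id2) = (0,0,0,0) \<and>
      redm (2 ^ (a+1)) (sub2 (M n) id2) \<noteq> (0,0,0,0) \<and>
      (let D = det2 (sub2 (M (Suc n)) id2) mod (2 ^ (n+1)) in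
              if n < 2*a + b then D = 0 else val_eq 2 D (2*a + b))" if "M \<in> G - cart" for M
  proof -
    have M: "M \<in> twist" "M \<in> Matl l" using H that twist_Matl by auto
    have "id_mod M a \<longleftrightarrow> redm (2 ^ a) (sub2 (M n) id2) = (0,0,0,0)"
      using id_mod_level[OF M(2), of a n] a(2) unfolding redm_sub2_eq_0 i2 by simp
    moreover have "id_mod M (Suc a) \<longleftrightarrow> redm (2 ^ (a+1)) (sub2 (M n) id2) = (0,0,0,0)"
      using id_mod_level[OF M(2), of "Suc a" n] a(2) unfolding redm_sub2_eq_0 i2 by simp
    moreover have "det_dvd M (min (n + eps) (2 * a + b)) \<and> (2 * a + b < n + eps \<longrightarrow> \<not> det_dvd M (Suc (2 * a + b))) \<longleftrightarrow>
      (let D = det2 (sub2 (M (Suc n)) id2) mod (2 ^ (n+1)) in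
              if n < 2*a + b then D = 0 else val_eq 2 D (2*a + b))"
      using det_dvd_val_iff[OF M(2) order_refl, of "Suc n" "2 * a + b", symmetric]
      unfolding e1 i2 Let_def v2 Suc_eq_plus1 le .
    ultimately show ?thesis unfolding good_def by blast
  qed
  show ?thesis
  proof (intro equalityI subsetI)
    fix A assume "A \<in> Nab l G cart a b n"
    then obtain M where M: "M \<in> G - cart" "M n = A" "redm (2 ^ a) (sub2 A id2) = (0,0,0,0)"
      "redm (2 ^ (a+1)) (sub2 A id2) \<noteq> (0,0,0,0)"
      "let D = det2 (sub2 (M (Suc n)) id2) mod (2 ^ (n+1)) in
              if n < 2*a + b then D = 0 else val_eq 2 D (2*a + b)"
      unfolding Nab_def using True by (simp only: if_False simp_thms) blast
    hence "good a b n M" using good[OF M(1)] by blast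
    thus "A \<in> img {M \<in> G - cart. good a b n M} n" using M(1,2) unfolding img_def by blast
  next
    fix A assume "A \<in> img {M \<in> G - cart. good a b n M} n"
    then obtain M where M: "M \<in> G - cart" "good a b n M" "A = M n" unfolding img_def by blast
    have "A \<in> img (G - cart) n" using M unfolding img_def by blast
    moreover note M(2)[unfolded good[OF M(1)]]
    ultimately show "A \<in> Nab l G cart a b n"
      unfolding Nab_def M(3) using True M(1) by (simp only: if_False simp_thms) blast
  qed
qed

text \<open>A lift inherits all digits that M determines, so only the digit at n + eps + 1 can
  impose a new condition.\<close>

lemma good_lift_iff:
  assumes M: "M \<in> twist" and n: "n > a" "n \<ge> 1" and good: "good a b n M" and M': "M' \<in> lifts M n"
  shows "good a b (Suc n) M' \<longleftrightarrow>
    (if n + eps < 2 * a + b then det_dvd M' (Suc (n + eps))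
     else if n + eps = 2 * a + b then \<not> det_dvd M' (Suc (n + eps)) else True)"
proof -
  have M'': "M' \<in> twist" "M n = M' n" using M' by (simp_all add: lifts_def)
  note Mat = twist_Matl[OF M] twist_Matl[OF M''(1)]
  have id_mod: "id_mod M' j \<longleftrightarrow> id_mod M j" if "j \<le> n" for j
    using that M''(2) id_mod_level[OF Mat(1)] id_mod_level[OF Mat(2)] by simp
  have det_dvd: "det_dvd M' j \<longleftrightarrow> det_dvd M j" if "j \<le> n + eps" for j
    using det_dvd_same_level[OF M M'' n(2) that] by simp
  show ?thesis
    using good id_mod[of a] id_mod[of "Suc a"] n det_dvd[of "2 * a + b"] det_dvd[of "Suc (2 * a + b)"]
    unfolding good_def by (auto simp: min_def)
qed

text \<open>The next digit is prescribed to vanish, prescribed not to vanish, or free. For l = 2 the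
  first two counts coincide because l - 1 = 1, which is why \<open>fN\<close> has only two values
  there.\<close>

lemma card_good_lifts:
  assumes M: "M \<in> twist" and n: "n > a" "n \<ge> 1 + eps" and good: "good a b n M" and a: "l \<noteq> 2 \<longrightarrow> a = 0"
  shows "card (img {M' \<in> lifts M n. good a b (Suc n) M'} (Suc n)) = fN l a b n"
proof -
  have n1: "n \<ge> 1" using n by simp
  have eps: "l = 2 \<Longrightarrow> eps = 1" "l \<noteq> 2 \<Longrightarrow> eps = 0" unfolding eps_def by simp_all
  note iff = good_lift_iff[OF M n(1) n1 good]
  consider "n + eps < 2 * a + b" | "n + eps = 2 * a + b" | "n + eps > 2 * a + b" by linarith
  thus ?thesis
  proof cases
    case 1
    hence "{M' \<in> lifts M n. good a b (Suc n) M'} = {M' \<in> lifts M n. det_dvd M' (Suc (n + eps))}"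
      using iff by auto
    moreover have "det_dvd M (n + eps)" using good 1 by (simp add: good_def min_def)
    moreover have "fN l a b n = l" using 1 eps a by (cases "l = 2") (simp_all add: fN_def power2_eq_square)
    ultimately show ?thesis using card_lifts(2)[OF M n(2)] by simp
  next
    case 2
    hence "{M' \<in> lifts M n. good a b (Suc n) M'} = {M' \<in> lifts M n. \<not> det_dvd M' (Suc (n + eps))}"
      using iff by auto
    moreover have "det_dvd M (n + eps)" using good 2 by (simp add: good_def min_def)
    moreover have "fN l a b n = l * (l - 1)" using 2 eps a by (cases "l = 2") (simp_all add: fN_def power2_eq_square)
    ultimately show ?thesis using card_lifts(3)[OF M n(2)] by simp
  next
    case 3
    hence "{M' \<in> lifts M n. good a b (Suc n) M'} = lifts M n"
      using iff by auto
    moreover have "fN l a b n = l\<^sup>2" using 3 eps a by (cases "l = 2") (simp_all add: fN_def power2_eq_square)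
    ultimately show ?thesis using card_lifts(1)[OF M n(2)] by simp
  qed
qed

section \<open>Fibres of the reduction and comparison with \<open>Mstar\<close>\<close>

lemma cart_Matl: "cart \<subseteq> Matl l"
  by (auto simp: cart_def GL2_def)

lemma fN_pos: "fN l a b n > 0"
  using l_gt_1 by (simp add: fN_def)

text \<open>Each fibre of the reduction is identified with the good lifts of one representative; the
  count of these no longer involves G.\<close>

lemma normalizer_theorem:
  assumes G: "open_subgroup_of l G (normalizer l cart)"
    and a: "l \<noteq> 2 \<longrightarrow> a = 0" "a \<le> 1"
  defines "n0 \<equiv> level l (normalizer l cart) G"
  shows "n \<ge> n0 \<Longrightarrow> n \<ge> 1 \<Longrightarrow> M\<^sub>0 \<in> Nab l G cart a b n \<Longrightarrow>
            card {M' \<in> Nab l G cart a b (Suc n). redm (int l ^ n) M' = M\<^sub>0} = fN l a b n"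
    and "n \<ge> n0 \<Longrightarrow> n \<ge> 1 \<Longrightarrow>
            card (Nab l G cart a b (Suc n)) = fN l a b n * card (Nab l G cart a b n)"
    and "n \<ge> n0 \<or> n > a + b \<Longrightarrow> n \<ge> 1 \<Longrightarrow>
            Mstar l G cart (normalizer l cart) a b n = Nab l G cart a b n"
proof -
  have GN: "G \<subseteq> normalizer l cart" using G by (simp add: open_subgroup_of_def)
  have H: "G - cart \<subseteq> twist" using GN normalizer_minus_cart by blast
  have n_ge: "n \<ge> 1 + eps" "n > a" if "n \<ge> n0" "n \<ge> 1" for n
  proof -
    \<comment> \<open>For l = 2 the level is at least 2 by definition, and 2 is 1 + eps and exceeds
      a.\<close>
    have "l = 2 \<Longrightarrow> n \<ge> 2" using that(1) level_ge[of "normalizer l cart" G] unfolding n0_def by simp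
    thus "n \<ge> 1 + eps" "n > a" using that(2) a unfolding eps_def by (cases "l = 2"; simp)+
  qed
  have lifts_G: "lifts M n \<subseteq> G - cart" if "n \<ge> n0" "M \<in> G - cart" for n M
  proof
    fix M' assume M': "M' \<in> lifts M n"
    hence "M' \<in> normalizer l cart" "M' \<notin> cart" "M' n = M n"
      using normalizer_minus_cart by (auto simp: lifts_def)
    thus "M' \<in> G - cart"
      using level_lift[OF cart_Matl refl G, of n M M'] that unfolding n0_def by blast
  qed
  have fibre: "{M' \<in> Nab l G cart a b (Suc n). redm (int l ^ n) M' = M n} =
      img {M' \<in> lifts M n. good a b (Suc n) M'} (Suc n)"
    if n: "n \<ge> n0" "n \<ge> 1" and M: "M \<in> G - cart" for M n
  proof -
    have red: "redm (int l ^ n) (M' (Suc n)) = M' n" if "M' \<in> G - cart" for M'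
      using that H twist_Matl by (intro Matl_redm) auto
    have "a < Suc n" using n_ge[OF n] by simp
    note Nab = Nab_eq[OF H a(1) this]
    show ?thesis
    proof (intro equalityI subsetI)
      fix A assume "A \<in> {M' \<in> Nab l G cart a b (Suc n). redm (int l ^ n) M' = M n}"
      then obtain M' where M': "M' \<in> G - cart" "good a b (Suc n) M'" "A = M' (Suc n)"
        and eq: "redm (int l ^ n) A = M n" unfolding Nab img_def by blast
      have "M' \<in> lifts M n" using eq red[OF M'(1)] M' H by (auto simp: lifts_def)
      thus "A \<in> img {M' \<in> lifts M n. good a b (Suc n) M'} (Suc n)" using M' by (auto simp: img_def)
    next
      fix A assume "A \<in> img {M' \<in> lifts M n. good a b (Suc n) M'} (Suc n)"
      then obtain M' where M': "M' \<in> lifts M n" "good a b (Suc n) M'" "A = M' (Suc n)"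
        unfolding img_def by blast
      have "M' \<in> G - cart" using lifts_G[OF n(1) M] M'(1) by blast
      moreover have "redm (int l ^ n) A = M n"
        using red[OF calculation] M'(1,3) by (simp add: lifts_def)
      ultimately show "A \<in> {M' \<in> Nab l G cart a b (Suc n). redm (int l ^ n) M' = M n}"
        unfolding Nab using M' by (auto simp: img_def)
    qed
  qed
  have card_fibre: "card {M' \<in> Nab l G cart a b (Suc n). redm (int l ^ n) M' = M\<^sub>0} = fN l a b n"
    if n: "n \<ge> n0" "n \<ge> 1" and M0: "M\<^sub>0 \<in> Nab l G cart a b n" for M\<^sub>0 n
  proof -
    obtain M where M: "M \<in> G - cart" "good a b n M" "M\<^sub>0 = M n"
      using M0 unfolding Nab_eq[OF H a(1) n_ge(2)[OF n]] img_def by blast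
    have "M \<in> twist" using M H by blast
    thus ?thesis
      unfolding M(3) fibre[OF n M(1)] by (intro card_good_lifts n_ge[OF n] M(2) a(1))
  qed
  thus "n \<ge> n0 \<Longrightarrow> n \<ge> 1 \<Longrightarrow> M\<^sub>0 \<in> Nab l G cart a b n \<Longrightarrow>
            card {M' \<in> Nab l G cart a b (Suc n). redm (int l ^ n) M' = M\<^sub>0} = fN l a b n" .
  have good_mono: "good a b n M" if "good a b (Suc n) M" "M \<in> Matl l" for n M
    using that det_dvd_antimono[OF that(2), of "min (Suc n + eps) (2 * a + b)" "min (n + eps) (2 * a + b)"]
    unfolding good_def by auto
  show "card (Nab l G cart a b (Suc n)) = fN l a b n * card (Nab l G cart a b n)"
    if n: "n \<ge> n0" "n \<ge> 1"
  proof -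
    note an = n_ge(2)[OF n]
    have GMat: "{M \<in> G - cart. good a b k M} \<subseteq> Matl l" for k using H twist_Matl by blast
    have fin: "finite (Nab l G cart a b n)" "finite (Nab l G cart a b (Suc n))"
      unfolding Nab_eq[OF H a(1) an] Nab_eq[OF H a(1) less_SucI[OF an]] by (rule finite_img[OF GMat])+
    \<comment> \<open>Reduction maps level n + 1 into level n, so its fibres partition the larger
      set into pieces of size \<open>fN l a b n\<close>.\<close>
    have "redm (int l ^ n) A \<in> Nab l G cart a b n" if A: "A \<in> Nab l G cart a b (Suc n)" for A
    proof -
      obtain M where M: "M \<in> G - cart" "good a b (Suc n) M" "A = M (Suc n)"
        using A unfolding Nab_eq[OF H a(1) less_SucI[OF an]] img_def by blast
      have Mat: "M \<in> Matl l" using M(1) H twist_Matl by blast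
      have "redm (int l ^ n) A = M n" unfolding M(3) using Mat by (rule Matl_redm) simp
      thus ?thesis
        unfolding Nab_eq[OF H a(1) an] img_def using M(1) good_mono[OF M(2) Mat] by blast
    qed
    hence sub: "redm (int l ^ n) ` Nab l G cart a b (Suc n) \<subseteq> Nab l G cart a b n" by blast
    have "card (Nab l G cart a b (Suc n)) =
        (\<Sum>M\<in>Nab l G cart a b n. card {M' \<in> Nab l G cart a b (Suc n). redm (int l ^ n) M' = M})"
      using sum.group[OF fin(2,1) sub, of "\<lambda>_. 1 :: nat"] by simp
    also have "\<dots> = (\<Sum>M\<in>Nab l G cart a b n. fN l a b n)"
      using card_fibre[OF n] by (intro sum.cong) auto
    finally show ?thesis by (simp add: mult.commute)
  qed
  show "Mstar l G cart (normalizer l cart) a b n = Nab l G cart a b n"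
    if n: "n \<ge> n0 \<or> n > a + b" "n \<ge> 1"
  proof -
    have an: "a < n" using n n_ge(2) by auto
    define full where "full M \<longleftrightarrow> id_mod M a \<and> \<not> id_mod M (Suc a) \<and> det_dvd M (2 * a + b) \<and> \<not> det_dvd M (Suc (2 * a + b))" for M
    have Mab: "M \<in> Mab l G a b \<longleftrightarrow> full M" if M: "M \<in> G - cart" for M
    proof -
      have Mt: "M \<in> twist" using M H by blast
      show ?thesis
        using M kerMI_iso_iff[OF twist_Matl[OF Mt] twist_not_id_mod_2[OF Mt], of a b]
        unfolding Mab_def full_def by blast
    qed
    have "Mab l G a b \<subseteq> G" unfolding Mab_def by blast
    hence "(normalizer l cart - cart) \<inter> Mab l G a b = {M \<in> G - cart. full M}"
      using GN Mab by blast
    hence Mstar: "Mstar l G cart (normalizer l cart) a b n = img {M \<in> G - cart. full M} n"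
      by (simp add: Mstar_def)
    have full_good: "good a b n M" if "full M" "M \<in> G - cart" for M
      using that det_dvd_antimono[of M "2 * a + b" "min (n + eps) (2 * a + b)"] H twist_Matl
      unfolding full_def good_def by auto
    have good_full: "full M" if "good a b k M" "2 * a + b < k + eps" for M k
      using that unfolding full_def good_def by (simp add: min_def)
    have lift: "\<exists>M'\<in>G - cart. M' n = M n \<and> full M'" if M: "M \<in> G - cart" "good a b n M" for M
    proof (cases "n \<ge> n0")
      case True
      \<comment> \<open>Positivity of \<open>fN\<close> provides a good lift at every step, and the
        reduction modulo \<open>l ^ n\<close> stays fixed.\<close>
      have "\<exists>M'\<in>G - cart. M' n = M n \<and> good a b (n + k) M'" for k
      proof (induction k)
        case 0 thus ?case using M by auto
      next
        case (Suc k)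
        then obtain M' where M': "M' \<in> G - cart" "M' n = M n" "good a b (n + k) M'" by blast
        have nk: "n + k \<ge> n0" "n + k \<ge> 1" using True n(2) by simp_all
        have "M' \<in> twist" using M' H by blast
        hence "card (img {M'' \<in> lifts M' (n + k). good a b (Suc (n + k)) M''} (Suc (n + k))) > 0"
          using card_good_lifts[OF _ n_ge(2,1)[OF nk] M'(3) a(1)] fN_pos by simp
        then obtain M'' where M'': "M'' \<in> lifts M' (n + k)" "good a b (Suc (n + k)) M''"
          unfolding img_def by (auto simp: card_gt_0_iff)
        have 1: "M'' \<in> G - cart" using lifts_G[OF nk(1) M'(1)] M''(1) by blast
        have "M'' n = M' n"
          using Matl_eq_le[of M'' l M' "n + k" n] M''(1) M'(1) H twist_Matl by (auto simp: lifts_def)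
        thus ?case using 1 M''(2) M'(2) by auto
      qed
      \<comment> \<open>At this level 2a + b < n + (2a + b) + eps because n \<ge> 1, so
        \<open>good\<close> includes the exact valuation.\<close>
      then obtain M' where "M' \<in> G - cart" "M' n = M n" "good a b (n + (2 * a + b)) M'" by blast
      thus ?thesis using good_full[of "n + (2 * a + b)" M'] n(2) by auto
    next
      case False
      hence "n > a + b" using n by blast
      \<comment> \<open>This rests on a \<le> eps.\<close>
      moreover have "a + b + 1 + eps > 2 * a + b"
        using a unfolding eps_def by (cases "l = 2") simp_all
      ultimately have "2 * a + b < n + eps" by linarith
      thus ?thesis using good_full M by blast
    qed
    show ?thesis
      unfolding Mstar Nab_eq[OF H a(1) an]
    proof (intro equalityI subsetI)
      fix A assume "A \<in> img {M \<in> G - cart. full M} n"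
      thus "A \<in> img {M \<in> G - cart. good a b n M} n" using full_good by (auto simp: img_def)
    next
      fix A assume "A \<in> img {M \<in> G - cart. good a b n M} n"
      then obtain M where "M \<in> G - cart" "good a b n M" "A = M n" by (auto simp: img_def)
      then obtain M' where "M' \<in> G - cart" "A = M' n" "full M'" using lift[of M] by auto
      thus "A \<in> img {M \<in> G - cart. full M} n" by (auto simp: img_def)
    qed
  qed
qed

end

theorem theorem15:
  fixes l :: nat and C N G :: "(nat \<Rightarrow> mat2) set" and a b n n0 :: nat
  assumes "Factorial_Ring.prime l"
    and "ramified_cartan l C"
    and "N = normalizer l C"
    and "open_subgroup_of l G N"
    and "n0 = level l N G"
    and "odd l \<Longrightarrow> a = 0"
    and "l = 2 \<Longrightarrow> a \<le> 1"
    and "n \<ge> 1"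
  shows "(n \<ge> n0 \<longrightarrow>
            (\<forall>M\<in>Nab l G C a b n.
               card {M' \<in> Nab l G C a b (Suc n). redm (int l ^ n) M' = M} = fN l a b n) \<and>
            card (Nab l G C a b (Suc n)) = fN l a b n * card (Nab l G C a b n))
       \<and> ((n \<ge> n0 \<or> n > a + b) \<longrightarrow> Mstar l G C N a b n = Nab l G C a b n)"
proof -
  obtain t d where td: "cartan_data l C t d" "int l dvd (t 1)\<^sup>2 - 4 * d 1"
    using assms(2) unfolding ramified_cartan_def by blast
  obtain P Q where PQ: "P \<in> GL2 l" "Q \<in> GL2 l" "lmul l P Q = lid l" "lmul l Q P = lid l"
    and C: "C = (\<lambda>A. lmul l P (lmul l A Q)) ` std_cartan l t d"
    and Zl: "t \<in> Zl l" "d \<in> Zl l" and disc: "\<exists>n. (t n ^ 2 - 4 * d n) mod (int l ^ n) \<noteq> 0"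
    using td(1) unfolding cartan_data_def by blast
  interpret ladic l by unfold_locales (rule assms(1))
  interpret cartan l t d P Q
    by unfold_locales
      (use PQ Zl_coh Zl td(2) disc in \<open>auto simp: null_def mod_eq_0_iff_dvd\<close>)
  have C: "C = cart" unfolding C by (rule std_cartan_conj[symmetric])
  have odd: "l \<noteq> 2 \<longrightarrow> a = 0"
    using assms(6) prime_odd_nat[OF prime_l] l_gt_1 by force
  have a1: "a \<le> 1" using odd assms(7) by (cases "l = 2") auto
  note main = normalizer_theorem[OF assms(4)[unfolded assms(3) C] odd a1]
  show ?thesis
    unfolding assms(3,5) C using main[where n = n and b = b] assms(8) by blast
qed

end
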